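(* Let $f$ be of the form $f(x,\xi)=\xi^\top Q\xi+x^\top R\xi+\ell(x)$, where $Q\in\mathbb{R}^{m\times m}$ is positive definite (in particular symmetric), $R\in\mathbb{R}^{d\times m}$, and $\ell:\mathbb{R}^d\to\mathbb{R}$ is a continuously differentiable convex function, and let $$\mathcal C=\mathbb{R}^{nd}\times\{\lambda_{\mathrm v}\in\mathbb{R}^n_{\ge0}\;|\;\lambda_{\mathrm v}\ge\lambda_{\max}(Q)\mathbf 1_n\}.$$ Assume further that there exists a saddle point $(x_{\mathrm v}^*,\lambda_{\mathrm v}^*,\nu^*,\eta^*,\{(\xi^k)^*\})$ of $\tilde L_{\mathrm{aug}}$ over $\mathcal C\times(\mathbb{R}^n\times\mathbb{R}^{nd}\times\mathbb{R}^{mN})$ satisfying $\lambda_{\mathrm v}^*>\lambda_{\max}(Q)\mathbf 1_n$. Then the trajectories of the saddle-point dynamics (SP) stated in the context starting in $\mathcal C\times\mathbb{R}^n\times\mathbb{R}^{nd}\times\mathbb{R}^{mN}$ remain in this set and converge asymptotically (as $t\to\infty$) to a saddle point of $\tilde L_{\mathrm{aug}}$ over $\mathcal C\times(\mathbb{R}^n\times\mathbb{R}^{nd}\times\mathbb{R}^{mN})$. As a consequence, the $(x_{\mathrm v},\lambda_{\mathrm v})$ component of the trajectory converges to an optimizer of problem (D) stated in the context.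
   Context: $n,N,d,m$ are positive integers and $\epsilon\ge 0$. $\mathcal G$ is a connected undirected weighted graph on the vertex set $\{1,\dots,n\}$ (the agents) with symmetric adjacency matrix $\mathsf A=(a_{ij})$, $a_{ij}>0$ if $(i,j)$ is an edge and $a_{ij}=0$ otherwise; $\mathsf L=\mathsf D-\mathsf A$ is its Laplacian, where $\mathsf D$ is the diagonal matrix with entries $\sum_j a_{ij}$. The samples $\hat\xi^{\,1},\dots,\hat\xi^{\,N}\in\mathbb{R}^m$ are distributed among the agents: each sample is held by exactly one agent and each agent holds at least one; $v_k\in\{1,\dots,n\}$ is the agent holding $\hat\xi^{\,k}$. Standing assumption on $f:\mathbb{R}^d\times\mathbb{R}^m\to\mathbb{R}$: the set of $\xi\in\mathbb{R}^m$ for which neither $\mathbf 1_d$ nor $-\mathbf 1_d$ is a direction of recession of $x\mapsto f(x,\xi)$ is dense in $\mathbb{R}^m$ (a vector $w$ is a direction of recession of a finite convex function $\phi$ if $\phi(x+\alpha w)\le\phi(x)$ for all $x$ and $\alpha\ge0$). Notation: $\lambda_{\max}(Q)$ is the largest eigenvalue of $Q$; $h(\lambda_{\mathrm v}):=\epsilon^2(\mathbf 1_n^\top\lambda_{\mathrm v})/n$; $g_k(x,\lambda,\xi):=f(x,\xi)-\lambda\|\xi-\hat\xi^{\,k}\|^2$; $x_{\mathrm v}=(x^1;\dots;x^n)$ with $x^i\in\mathbb{R}^d$; $\lambda_{\mathrm v}=(\lambda^1;\dots;\lambda^n)$ with $\lambda^i\in\mathbb{R}$; $\nu\in\mathbb{R}^n$;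 $\eta\in\mathbb{R}^{nd}$; $\{\xi^k\}=(\xi^1,\dots,\xi^N)$ with $\xi^k\in\mathbb{R}^m$; $$F(x_{\mathrm v},\lambda_{\mathrm v}):=h(\lambda_{\mathrm v})+\frac1N\sum_{k=1}^N\max_{\xi\in\mathbb{R}^m}g_k(x^{v_k},\lambda^{v_k},\xi)\in(-\infty,+\infty],$$ $$\tilde L_{\mathrm{aug}}(x_{\mathrm v},\lambda_{\mathrm v},\nu,\eta,\{\xi^k\}):=h(\lambda_{\mathrm v})+\frac1N\sum_{k=1}^Ng_k(x^{v_k},\lambda^{v_k},\xi^k)+\nu^\top\mathsf L\lambda_{\mathrm v}+\eta^\top(\mathsf L\otimes\mathsf I_d)x_{\mathrm v}+\tfrac12x_{\mathrm v}^\top(\mathsf L\otimes\mathsf I_d)x_{\mathrm v}+\tfrac12\lambda_{\mathrm v}^\top\mathsf L\lambda_{\mathrm v}.$$ $\mathbf 1_n,\mathbf 0_n$ are the all-ones and zero vectors, $\mathsf I_d$ the identity, $\otimes$ the Kronecker product; vector inequalities are componentwise. Problem (D): minimize $F(x_{\mathrm v},\lambda_{\mathrm v})$ over $x_{\mathrm v}\in\mathbb{R}^{nd}$, $\lambda_{\mathrm v}\ge\mathbf 0_n$ subject to $\mathsf L\lambda_{\mathrm v}=\mathbf 0_n$ and $(\mathsf L\otimes\mathsf I_d)x_{\mathrm v}=\mathbf 0_{nd}$. Standing assumption: for problem (P), $\inf_{\lambda\ge0,\,x\in\mathbb{R}^d}\{\lambda\epsilon^2+\frac1N\sum_{k=1}^N\max_{\xi\in\mathbb{R}^m}g_k(x,\lambda,\xi)\}$,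 the set of $(\lambda,x)\in\mathbb{R}_{\ge0}\times\mathbb{R}^d$ at which the objective is finite has nonempty interior, and there exists a finite optimizer $(x^*,\lambda^* )$. A point $(p_*,q_* )\in\mathcal P\times\mathcal Q$ is a saddle point of $\Phi$ over $\mathcal P\times\mathcal Q$ if $\Phi(p_*,q)\le\Phi(p_*,q_* )\le\Phi(p,q_* )$ for all $p\in\mathcal P$, $q\in\mathcal Q$. For a closed convex set $\mathcal K$, $y\in\mathcal K$ and a vector $w$, $\Pi_{\mathcal K}(y,w):=\lim_{\delta\to0^+}\frac{\mathrm{proj}_{\mathcal K}(y+\delta w)-y}{\delta}$, where $\mathrm{proj}_{\mathcal K}$ is the Euclidean projection onto $\mathcal K$. The saddle-point dynamics (SP) is, with all gradients of $\tilde L_{\mathrm{aug}}$ evaluated at $(x_{\mathrm v},\lambda_{\mathrm v},\nu,\eta,\{\xi^k\})$, $$\frac{d}{dt}\begin{bmatrix}x_{\mathrm v}\\ \lambda_{\mathrm v}\end{bmatrix}=\Pi_{\mathcal C}\Bigl((x_{\mathrm v},\lambda_{\mathrm v}),\begin{bmatrix}-\nabla_{x_{\mathrm v}}\tilde L_{\mathrm{aug}}\\-\nabla_{\lambda_{\mathrm v}}\tilde L_{\mathrm{aug}}\end{bmatrix}\Bigr),\quad \frac{d\nu}{dt}=\nabla_\nu\tilde L_{\mathrm{aug}},\quad\frac{d\eta}{dt}=\nabla_\eta\tilde L_{\mathrm{aug}},\quad\frac{d\xi^k}{dt}=\nabla_{\xi^k}\tilde L_{\mathrm{aug}}\;\;(k=1,\dots,N).$$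 Trajectories are Caratheodory solutions: absolutely continuous curves satisfying the equations for almost every time. *)

theory Defs
  imports "HOL-Analysis.Analysis"
begin

text \<open>
  Agents are indexed by the type \<open>'n\<close>, samples by \<open>'k\<close>; points of \<open>R^d\<close>, \<open>R^m\<close> are
  \<open>real^'d\<close>, \<open>real^'m\<close>. A stacked vector in \<open>R^{nd}\<close> has type \<open>real^('n \<times> 'd)\<close>, so that
  the Kronecker product of matrices acts on it by \<open>*v\<close>; the family of the \<open>xi^k\<close> has type
  \<open>real^'m^'k\<close>. The library order on \<open>real^'n\<close> is componentwise for \<open>\<le>\<close>, but its \<open><\<close> only means
  \<open>\<le>\<close> and \<open>\<noteq>\<close>, so componentwise strict inequalities are written out with a quantifier.
\<close>

section \<open>Matrices and graphs\<close>

definition kron :: "real^'a^'b \<Rightarrow> real^'p^'q \<Rightarrow> real^('a::finite \<times> 'p::finite)^('b::finite \<times> 'q::finite)" where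
  "kron A B = (\<chi> i j. A $ fst i $ fst j * B $ snd i $ snd j)"

definition block :: "real^('n::finite \<times> 'd::finite) \<Rightarrow> 'n \<Rightarrow> real^'d" where
  "block x i = (\<chi> j. x $ (i, j))"

definition eigenvalue :: "real^'m^'m \<Rightarrow> real \<Rightarrow> bool" where
  "eigenvalue M c \<longleftrightarrow> (\<exists>v. v \<noteq> 0 \<and> M *v v = c *\<^sub>R v)"

definition lambda_max :: "real^'m^'m \<Rightarrow> real" where
  "lambda_max M = (GREATEST c. eigenvalue M c)"

definition positive_definite :: "real^'m^'m \<Rightarrow> bool" where
  "positive_definite M \<longleftrightarrow> transpose M = M \<and> (\<forall>v. v \<noteq> 0 \<longrightarrow> 0 < v \<bullet> (M *v v))"

definition connected_weighted_graph :: "('n::finite \<times> 'n) set \<Rightarrow> real^'n^'n \<Rightarrow> bool" where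
  "connected_weighted_graph E A \<longleftrightarrow>
     sym E \<and> transpose A = A \<and>
     (\<forall>i j. (i, j) \<in> E \<longrightarrow> 0 < A $ i $ j) \<and>
     (\<forall>i j. (i, j) \<notin> E \<longrightarrow> A $ i $ j = 0) \<and>
     (\<forall>i j. (i, j) \<in> E\<^sup>*)"

definition degree_matrix :: "real^'n^'n \<Rightarrow> real^'n^'n" where
  "degree_matrix A = (\<chi> i j. if i = j then (\<Sum>l\<in>UNIV. A $ i $ l) else 0)"

definition laplacian :: "real^'n^'n \<Rightarrow> real^'n^'n" where
  "laplacian A = degree_matrix A - A"

section \<open>Analysis\<close>

definition recession_direction :: "('a::real_vector \<Rightarrow> real) \<Rightarrow> 'a \<Rightarrow> bool" where
  "recession_direction \<phi> w \<longleftrightarrow> (\<forall>x. \<forall>\<alpha>\<ge>0. \<phi> (x + \<alpha> *\<^sub>R w) \<le> \<phi> x)"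

definition grad :: "('a::real_inner \<Rightarrow> real) \<Rightarrow> 'a \<Rightarrow> 'a" where
  "grad \<phi> x = (THE D. GDERIV \<phi> x :> D)"

definition cont_diff :: "('a::real_inner \<Rightarrow> real) \<Rightarrow> bool" where
  "cont_diff \<phi> \<longleftrightarrow> (\<exists>D. (\<forall>x. GDERIV \<phi> x :> D x) \<and> continuous_on UNIV D)"

definition abs_continuous_on :: "real set \<Rightarrow> (real \<Rightarrow> 'a::real_normed_vector) \<Rightarrow> bool" where
  "abs_continuous_on S z \<longleftrightarrow>
     (\<forall>e>0. \<exists>d>0. \<forall>I :: (real \<times> real) set.
        finite I \<longrightarrow>
        (\<forall>(a, b)\<in>I. a \<le> b \<and> {a..b} \<subseteq> S) \<longrightarrow>
        disjoint_family_on (\<lambda>(a, b). {a<..<b}) I \<longrightarrow>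
        (\<Sum>(a, b)\<in>I. b - a) < d \<longrightarrow>
        (\<Sum>(a, b)\<in>I. norm (z b - z a)) < e)"

text \<open>
  \<open>proj_direction K y w p\<close> says that the limit defining \<open>\<Pi>\<^sub>K(y, w)\<close> exists and equals \<open>p\<close>.
  For \<open>y\<close> outside a closed convex \<open>K\<close> the limit does not exist, so the relation is then false; a total
  function built from \<open>Lim\<close> would take an unspecified value there.
\<close>

definition proj_direction :: "'a::euclidean_space set \<Rightarrow> 'a \<Rightarrow> 'a \<Rightarrow> 'a \<Rightarrow> bool" where
  "proj_direction K y w p \<longleftrightarrow>
     ((\<lambda>\<delta>. (1 / \<delta>) *\<^sub>R (closest_point K (y + \<delta> *\<^sub>R w) - y)) \<longlongrightarrow> p) (at_right 0)"

definition saddle_point :: "('p \<Rightarrow> 'q \<Rightarrow> real) \<Rightarrow> 'p set \<Rightarrow> 'q set \<Rightarrow> 'p \<Rightarrow> 'q \<Rightarrow> bool" where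
  "saddle_point \<Phi> P Q p\<^sub>0 q\<^sub>0 \<longleftrightarrow>
     p\<^sub>0 \<in> P \<and> q\<^sub>0 \<in> Q \<and> (\<forall>p\<in>P. \<forall>q\<in>Q. \<Phi> p\<^sub>0 q \<le> \<Phi> p\<^sub>0 q\<^sub>0 \<and> \<Phi> p\<^sub>0 q\<^sub>0 \<le> \<Phi> p q\<^sub>0)"

section \<open>The optimization problems\<close>

text \<open>
  Throughout, \<open>s k\<close> is the \<open>k\<close>-th sample, \<open>v k\<close> the agent holding it, and \<open>L\<close> the Laplacian.
  The maxima over \<open>\<xi>\<close> are suprema in the extended reals.
\<close>

definition g_k :: "(real^'d \<Rightarrow> real^'m \<Rightarrow> real) \<Rightarrow> ('k \<Rightarrow> real^'m) \<Rightarrow> 'k \<Rightarrow>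
    real^'d \<Rightarrow> real \<Rightarrow> real^'m \<Rightarrow> real" where
  "g_k f s k x lam \<xi> = f x \<xi> - lam * (norm (\<xi> - s k))\<^sup>2"

definition h_reg :: "real \<Rightarrow> real^'n \<Rightarrow> real" where
  "h_reg \<epsilon> lam = \<epsilon>\<^sup>2 * (1 \<bullet> lam) / real CARD('n)"

definition P_objective :: "(real^'d \<Rightarrow> real^'m \<Rightarrow> real) \<Rightarrow> real \<Rightarrow> ('k::finite \<Rightarrow> real^'m) \<Rightarrow>
    real \<Rightarrow> real^'d \<Rightarrow> ereal" where
  "P_objective f \<epsilon> s lam x =
     ereal (lam * \<epsilon>\<^sup>2) +
     ereal (1 / real CARD('k)) * (\<Sum>k\<in>UNIV. SUP \<xi>. ereal (g_k f s k x lam \<xi>))"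

definition F_obj :: "(real^'d \<Rightarrow> real^'m \<Rightarrow> real) \<Rightarrow> real \<Rightarrow> ('k::finite \<Rightarrow> real^'m) \<Rightarrow>
    ('k \<Rightarrow> 'n) \<Rightarrow> real^('n::finite \<times> 'd::finite) \<Rightarrow> real^'n \<Rightarrow> ereal" where
  "F_obj f \<epsilon> s v x lam =
     ereal (h_reg \<epsilon> lam) +
     ereal (1 / real CARD('k)) *
       (\<Sum>k\<in>UNIV. SUP \<xi>. ereal (g_k f s k (block x (v k)) (lam $ v k) \<xi>))"

definition D_feasible :: "real^'n^'n \<Rightarrow> ((real^('n::finite \<times> 'd::finite)) \<times> (real^'n)) set" where
  "D_feasible L =
     {(x, lam). 0 \<le> lam \<and> L *v lam = 0 \<and> kron L (mat 1 :: real^'d^'d) *v x = 0}"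

definition D_optimizer :: "(real^'d \<Rightarrow> real^'m \<Rightarrow> real) \<Rightarrow> real \<Rightarrow> ('k::finite \<Rightarrow> real^'m) \<Rightarrow>
    ('k \<Rightarrow> 'n) \<Rightarrow> real^'n^'n \<Rightarrow> real^('n::finite \<times> 'd::finite) \<Rightarrow> real^'n \<Rightarrow> bool" where
  "D_optimizer f \<epsilon> s v L x lam \<longleftrightarrow>
     (x, lam) \<in> D_feasible L \<and>
     (\<forall>(x', lam') \<in> D_feasible L. F_obj f \<epsilon> s v x lam \<le> F_obj f \<epsilon> s v x' lam')"

definition L_aug :: "(real^'d \<Rightarrow> real^'m \<Rightarrow> real) \<Rightarrow> real \<Rightarrow> ('k::finite \<Rightarrow> real^'m) \<Rightarrow>
    ('k \<Rightarrow> 'n) \<Rightarrow> real^'n^'n \<Rightarrow>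
    real^('n::finite \<times> 'd::finite) \<Rightarrow> real^'n \<Rightarrow> real^'n \<Rightarrow> real^('n \<times> 'd) \<Rightarrow> real^'m^'k \<Rightarrow> real" where
  "L_aug f \<epsilon> s v L x lam \<nu> \<eta> \<xi> =
     h_reg \<epsilon> lam
     + 1 / real CARD('k) * (\<Sum>k\<in>UNIV. g_k f s k (block x (v k)) (lam $ v k) (\<xi> $ k))
     + \<nu> \<bullet> (L *v lam)
     + \<eta> \<bullet> (kron L (mat 1 :: real^'d^'d) *v x)
     + 1/2 * (x \<bullet> (kron L (mat 1 :: real^'d^'d) *v x))
     + 1/2 * (lam \<bullet> (L *v lam))"

definition L_aug_saddle_point :: "(real^'d \<Rightarrow> real^'m \<Rightarrow> real) \<Rightarrow> real \<Rightarrow>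
    ('k::finite \<Rightarrow> real^'m) \<Rightarrow> ('k \<Rightarrow> 'n) \<Rightarrow> real^'n^'n \<Rightarrow> ((real^('n::finite \<times> 'd::finite)) \<times> (real^'n)) set \<Rightarrow>
    real^('n \<times> 'd) \<Rightarrow> real^'n \<Rightarrow> real^'n \<Rightarrow> real^('n \<times> 'd) \<Rightarrow> real^'m^'k \<Rightarrow> bool" where
  "L_aug_saddle_point f \<epsilon> s v L C x lam \<nu> \<eta> \<xi> \<longleftrightarrow>
     saddle_point (\<lambda>(x, lam) (\<nu>, \<eta>, \<xi>). L_aug f \<epsilon> s v L x lam \<nu> \<eta> \<xi>)
       C UNIV (x, lam) (\<nu>, \<eta>, \<xi>)"

section \<open>The saddle-point dynamics\<close>

text \<open>Caratheodory solutions on \<open>[0, \<infinity>)\<close>, absolutely continuous on every compact subinterval.\<close>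

definition SP_trajectory :: "(real^'d \<Rightarrow> real^'m \<Rightarrow> real) \<Rightarrow> real \<Rightarrow>
    ('k::finite \<Rightarrow> real^'m) \<Rightarrow> ('k \<Rightarrow> 'n) \<Rightarrow> real^'n^'n \<Rightarrow> ((real^('n::finite \<times> 'd::finite)) \<times> (real^'n)) set \<Rightarrow>
    (real \<Rightarrow> real^('n \<times> 'd)) \<Rightarrow> (real \<Rightarrow> real^'n) \<Rightarrow> (real \<Rightarrow> real^'n) \<Rightarrow>
    (real \<Rightarrow> real^('n \<times> 'd)) \<Rightarrow> (real \<Rightarrow> real^'m^'k) \<Rightarrow> bool" where
  "SP_trajectory f \<epsilon> s v L C x lam \<nu> \<eta> \<xi> \<longleftrightarrow>
     (\<forall>T\<ge>0. abs_continuous_on {0..T} (\<lambda>t. (x t, lam t, \<nu> t, \<eta> t, \<xi> t))) \<and>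
     (AE t in lebesgue. t > 0 \<longrightarrow>
        (\<exists>p. ((\<lambda>r. (x r, lam r)) has_vector_derivative p) (at t) \<and>
             proj_direction C (x t, lam t)
               (- grad (\<lambda>y. L_aug f \<epsilon> s v L y (lam t) (\<nu> t) (\<eta> t) (\<xi> t)) (x t),
                - grad (\<lambda>y. L_aug f \<epsilon> s v L (x t) y (\<nu> t) (\<eta> t) (\<xi> t)) (lam t)) p) \<and>
        (\<nu> has_vector_derivative
           grad (\<lambda>y. L_aug f \<epsilon> s v L (x t) (lam t) y (\<eta> t) (\<xi> t)) (\<nu> t)) (at t) \<and>
        (\<eta> has_vector_derivative
           grad (\<lambda>y. L_aug f \<epsilon> s v L (x t) (lam t) (\<nu> t) y (\<xi> t)) (\<eta> t)) (at t) \<and>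
        (\<forall>k. ((\<lambda>r. \<xi> r $ k) has_vector_derivative
           grad (\<lambda>y. L_aug f \<epsilon> s v L (x t) (lam t) (\<nu> t) (\<eta> t)
                   (\<chi> j. if j = k then y else \<xi> t $ j)) (\<xi> t $ k)) (at t)))"

end

(* Proof idea. Write p = (x, lam) and q = (nu, eta, xi). On C the augmented Lagrangian is convex in p
   and concave in q, so the squared distance of a trajectory to any saddle point (a, b) does not
   increase; its rate of decrease is at least the "dissipation" Gp.(p - a) - Gq.(q - b) >= 0, where
   Gp, Gq are the partial gradients. Trajectories are bounded and Lipschitz, so by Barbalat's lemma the
   dissipation tends to 0. Zero dissipation forces L lam = 0 and (L kron I) x = 0 (augmentation terms)
   and fixes xi (strict concavity, as the lam component of a exceeds lambda_max Q). Hence dnu/dt and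
   deta/dt tend to 0, and dxi/dt does by Barbalat once more: q moves arbitrarily slowly.

   This replaces the invariance principle for the discontinuous projected dynamics: let (p', q') be a
   limit point. It has saddle value and q' maximizes the Lagrangian at p'. If some c in C had a value
   at q' below the saddle value, then during arbitrarily long time intervals in which q stays close
   to q' the quantity |p - c|^2 / 2 would decrease at a rate bounded away from 0, contradicting boundedness.
   So (p', q') is a saddle point, and the distance to it is nonincreasing with limit 0 along a
   subsequence.

   The projected dynamics enters only through the variational inequality
   u.(y - c) <= w.(y - c) for c in C and the bound |u| <= |w|, where u is the projected direction of w
   at y. *)
theory Submission
  imports Defs
begin

text \<open>The obstacle is that the projected velocity of p is discontinuous. Barbalat's lemma
  applies to continuous functions of the state, such as the dissipation and the q-velocity, and says
  nothing about dp/dt. Optimality of a limit point in p is therefore tested through values of the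
  Lagrangian against a competitor c, and such a test needs q almost frozen over long windows. This
  is why decay of the entire q-velocity has to come first.

  A trajectory may run along the face where some component of lam equals
  \<open>lambda_max Q\<close>, where concavity in xi is no longer strict. The dissipation relative
  to (a, b) contains the concavity gap evaluated at a, not only the one at the current point, so
  strictness at the reference saddle point pins xi wherever the trajectory happens to be. The limit
  saddle point may lie on that face: the distance estimate at the end holds for every saddle point.

  Since derivatives exist almost everywhere only and all estimates are one-sided, the calculus
  needed is a one-sided bound on increments rather than an integral representation.\<close>

section \<open>Absolutely continuous functions\<close>

text \<open>
  A gauge argument: at points outside \<open>N\<close> the gauge makes the increments almost \<open>\<le> c (y - x)\<close>; at points
  of \<open>N\<close> it confines the intervals to an open set of small measure, where absolute continuity applies.
\<close>
lemma abs_continuous_derivative_bound: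
  fixes u :: "real \<Rightarrow> real"
  assumes "a \<le> b" and ac: "abs_continuous_on {a..b} u" and N: "negligible N"
    and der: "\<And>t. t \<in> {a..b} - N \<Longrightarrow> \<exists>d\<le>c. (u has_real_derivative d) (at t within {a..b})"
  shows "u b - u a \<le> c * (b - a)"
proof (rule field_le_epsilon)
  fix \<epsilon> :: real assume "\<epsilon> > 0"
  \<comment> \<open>The total error will be \<open>e * (b - a)\<close> from the good intervals plus
    \<open>2 * e\<close> from the bad ones: \<open>e\<close> for the increments of \<open>u\<close>
    and \<open>e\<close> for the subtracted slope.\<close>
  define e where "e = \<epsilon> / (b - a + 2)"
  have e: "e > 0" using \<open>\<epsilon> > 0\<close> \<open>a \<le> b\<close> by (simp add: e_def)
  obtain d0 where d0: "d0 > 0" and dI: "\<forall>I :: (real \<times> real) set. finite I \<longrightarrow>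
      (\<forall>(x, y)\<in>I. x \<le> y \<and> {x..y} \<subseteq> {a..b}) \<longrightarrow> disjoint_family_on (\<lambda>(x, y). {x<..<y}) I \<longrightarrow>
      (\<Sum>(x, y)\<in>I. y - x) < d0 \<longrightarrow> (\<Sum>(x, y)\<in>I. norm (u y - u x)) < e"
    using ac[unfolded abs_continuous_on_def, THEN spec, THEN mp, OF e] by (elim exE conjE)
  note dI0 = dI[THEN spec, THEN mp, THEN mp, THEN mp, THEN mp]
  \<comment> \<open>The second bound makes \<open>\<bar>c\<bar>\<close> times the total length of
    the bad intervals at most \<open>e\<close>.\<close>
  define d where "d = min d0 (e / (\<bar>c\<bar> + 1))"
  have d: "d > 0" using d0 e by (simp add: d_def)
  have ced: "\<bar>c\<bar> * d \<le> e"
  proof -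
    have "\<bar>c\<bar> * d \<le> (\<bar>c\<bar> + 1) * (e / (\<bar>c\<bar> + 1))" using e d by (intro mult_mono) (auto simp: d_def)
    also have "\<bar>c\<bar> + 1 \<noteq> 0" by linarith
    then have "(\<bar>c\<bar> + 1) * (e / (\<bar>c\<bar> + 1)) = e" by simp
    finally show ?thesis .
  qed
  have Ns: "N \<in> sets lebesgue" using N by (simp add: negligible_imp_sets)
  obtain G where G: "open G" "N \<subseteq> G" "G - N \<in> lmeasurable" "emeasure lebesgue (G - N) < ennreal d"
    using sets_lebesgue_outer_open[OF Ns d] by blast
  have Glm: "G \<in> lmeasurable"
    using fmeasurable.Un[OF G(3) negligible_imp_measurable[OF N]] G(2) by (simp add: Un_absorb2)
  have Gd: "measure lebesgue G < d"
  proof -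
    have "measure lebesgue (G - N) < d"
      using G(3,4) d by (simp add: emeasure_eq_measure2 ennreal_less_iff)
    then show ?thesis using N Glm by (simp add: measure_Diff_null_set negligible_iff_null_sets fmeasurableD)
  qed
  have "\<exists>r>0. (t \<in> N \<longrightarrow> ball t r \<subseteq> G) \<and>
      (t \<in> {a..b} - N \<longrightarrow> (\<forall>x y. x \<in> {a..b} \<and> y \<in> {a..b} \<and> x \<in> ball t r \<and> y \<in> ball t r \<and> x \<le> t \<and> t \<le> y \<longrightarrow>
         u y - u x \<le> (c + e) * (y - x)))" for t
  proof (cases "t \<in> N")
    case True
    then obtain r where "r > 0" "ball t r \<subseteq> G" using G(1,2) by (meson openE subsetD)
    then show ?thesis using True by auto
  next
    case False
    show ?thesis
    proof (cases "t \<in> {a..b}")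
      case t: True
      then obtain D where D: "D \<le> c" "(u has_real_derivative D) (at t within {a..b})" using der False by blast
      from D(2) have "(u has_derivative (\<lambda>h. D * h)) (at t within {a..b})" 
        by (simp add: has_field_derivative_def)
      then obtain r where r: "r > 0" "\<And>y. \<lbrakk>y \<in> {a..b}; norm (y - t) < r\<rbrakk> \<Longrightarrow> norm (u y - u t - D * (y - t)) \<le> e * norm (y - t)"
        unfolding has_derivative_within_alt using e by metis
      have "u y - u x \<le> (c + e) * (y - x)" if "x \<in> {a..b}" "y \<in> {a..b}" "x \<in> ball t r" "y \<in> ball t r" "x \<le> t" "t \<le> y" for x y
      proof -
        have "u y - u t - D * (y - t) \<le> e * (y - t)" using r(2)[of y] that by (auto simp: dist_norm abs_minus_commute)
        moreover have "- (u x - u t - D * (x - t)) \<le> e * (t - x)" using r(2)[of x] that by (auto simp: dist_norm abs_minus_commute)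
        ultimately have "u y - u x \<le> (D + e) * (y - x)" by (simp add: algebra_simps)
        also have "\<dots> \<le> (c + e) * (y - x)" using D that by (intro mult_right_mono) auto
        finally show ?thesis .
      qed
      then show ?thesis using False r(1) by blast
    qed (use False in \<open>auto intro: exI[of _ 1]\<close>)
  qed
  then obtain r where r: "\<And>t. r t > 0" "\<And>t. t \<in> N \<Longrightarrow> ball t (r t) \<subseteq> G"
    and rN: "\<And>t x y. \<lbrakk>t \<in> {a..b} - N; x \<in> {a..b}; y \<in> {a..b}; x \<in> ball t (r t); y \<in> ball t (r t); x \<le> t; t \<le> y\<rbrakk> \<Longrightarrow>
         u y - u x \<le> (c + e) * (y - x)" by metis
  have "gauge (\<lambda>t. ball t (r t))" using r(1) by (simp add: gauge_def)
  then obtain p where p: "p tagged_division_of {a..b}" "(\<lambda>t. ball t (r t)) fine p"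
    using fine_division_exists_real by blast
  note pD = tagged_division_ofD[OF p(1)]
  have fp: "finite p" using p by auto
  have int: "\<exists>x y. K = {x..y} \<and> x \<le> t \<and> t \<le> y \<and> Inf K = x \<and> Sup K = y \<and> x \<in> {a..b} \<and> y \<in> {a..b}
       \<and> K \<subseteq> ball t (r t) \<and> x \<in> ball t (r t) \<and> y \<in> ball t (r t) \<and> t \<in> {a..b} \<and> {x..y} \<subseteq> {a..b}" if tK: "(t, K) \<in> p" for t K
  proof -
    obtain x y where xy: "K = {x..y}" using pD(4)[OF tK] by auto
    have t: "t \<in> {x..y}" using pD(2)[OF that] xy by simp
    have "K \<subseteq> ball t (r t)" using p(2) that unfolding fine_def by blast
    moreover have "{x..y} \<subseteq> {a..b}" using pD(3)[OF that] xy by simp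
    moreover have "x \<in> {x..y}" "y \<in> {x..y}" using t by auto
    ultimately show ?thesis using xy t by (intro exI[of _ x] exI[of _ y]) (auto simp: subset_iff)
  qed
  have intK: "interior K = {Inf K<..<Sup K}" "measure lebesgue K = Sup K - Inf K" "Inf K \<le> Sup K"
      "{Inf K..Sup K} \<subseteq> {a..b}" if tK: "(t, K) \<in> p" for t K
  proof -
    obtain x y where "K = {x..y}" "Inf K = x" "Sup K = y" "x \<le> t" "t \<le> y" "{x..y} \<subseteq> {a..b}" using int[OF tK] by blast
    then show "interior K = {Inf K<..<Sup K}" "measure lebesgue K = Sup K - Inf K" "Inf K \<le> Sup K"
      "{Inf K..Sup K} \<subseteq> {a..b}" by auto
  qed
  define B where "B = {(t, K) \<in> p. t \<in> N}"
  have Bp: "B \<subseteq> p" "finite B" using fp by (auto simp: B_def intro: finite_subset)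
  define I where "I = (\<lambda>(t, K). (Inf K, Sup K)) ` B"
  \<comment> \<open>Two different tagged pieces can share an interval only if it is a single point,
    because their interiors are disjoint. Passing from the tagged pieces to the set \<open>I\<close>
    of endpoint pairs may merge such pieces, which is harmless since they contribute zero to the
    sums.\<close>
  have deg: "Inf K = Sup K" if "(t, K) \<in> p" "(t', K') \<in> p" "(t, K) \<noteq> (t', K')" "(Inf K, Sup K) = (Inf K', Sup K')" for t K t' K'
  proof -
    have "K = K'" using int[OF that(1)] int[OF that(2)] that(4) by auto
    then have "interior K = {}" using pD(5)[OF that(1,2,3)] by simp
    then show ?thesis using intK(1,3)[OF that(1)] by auto
  qed
  have sumI: "(\<Sum>(x, y)\<in>I. g x y) = (\<Sum>(t, K)\<in>B. g (Inf K) (Sup K))" if "\<And>x. g x x = 0" for g :: "real \<Rightarrow> real \<Rightarrow> real"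
    unfolding I_def
  proof (subst sum.reindex_nontrivial)
    fix z w assume *: "z \<in> B" "w \<in> B" "z \<noteq> w" "(\<lambda>(t, K). (Inf K, Sup K)) z = (\<lambda>(t, K). (Inf K, Sup K)) w"
    obtain t K t' K' where zw: "z = (t, K)" "w = (t', K')" by (meson surj_pair)
    then have "Inf K = Sup K" using deg[of t K t' K'] * Bp(1) by auto
    then show "(\<lambda>(x, y). g x y) ((\<lambda>(t, K). (Inf K, Sup K)) z) = 0" using that zw by simp
  qed (auto simp: Bp case_prod_unfold)
  \<comment> \<open>The bad pieces form a division of their union, so their total length is its
    measure, and fineness of the gauge places that union inside \<open>G\<close>.\<close>
  have "(\<Sum>(t, K)\<in>B. Sup K - Inf K) < d"
  proof -
    have tp: "B tagged_partial_division_of {a..b}"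
      using p(1) Bp unfolding tagged_division_of_def by (meson tagged_partial_division_subset)
    have div: "(snd ` B) division_of \<Union>(snd ` B)" by (rule partial_division_of_tagged_division[OF tp])
    have "(\<Sum>(t, K)\<in>B. Sup K - Inf K) = (\<Sum>(t, K)\<in>B. measure lebesgue K)"
    proof (intro sum.cong refl, clarify)
      fix t K assume "(t, K) \<in> B"
      then show "Sup K - Inf K = measure lebesgue K" using intK(2)[of t K] Bp(1) by auto
    qed
    also have "\<dots> = (\<Sum>K\<in>snd ` B. measure lebesgue K)"
    proof (subst sum.reindex_nontrivial)
      fix z w assume *: "z \<in> B" "w \<in> B" "z \<noteq> w" "snd z = snd w"
      obtain t K t' K' where zw: "z = (t, K)" "w = (t', K')" by (meson surj_pair)
      then have "Inf K = Sup K" using deg[of t K t' K'] * Bp(1) by auto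
      moreover have "(t, K) \<in> p" using * Bp(1) zw by auto
      ultimately show "measure lebesgue (snd z) = 0" using intK(2)[of t K] zw by simp
    qed (auto simp: Bp case_prod_unfold)
    also have "\<dots> = measure lebesgue (\<Union>(snd ` B))" by (rule content_division[OF div])
    also have "\<dots> \<le> measure lebesgue G"
    proof (rule measure_mono_fmeasurable[OF _ _ Glm])
      show "\<Union>(snd ` B) \<subseteq> G"
      proof clarsimp
        fix x t K assume "(t, K) \<in> B" "x \<in> K"
        then show "x \<in> G" using int[of t K] r(2)[of t] by (auto simp: B_def)
      qed
      show "\<Union>(snd ` B) \<in> sets lebesgue" using lmeasurable_division[OF div] by blast
    qed
    finally show ?thesis using Gd by simp
  qed
  note lenB = this
  then have "(\<Sum>(x, y)\<in>I. y - x) < d0" by (subst sumI) (auto simp: d_def)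
  moreover have "disjoint_family_on (\<lambda>(x, y). {x<..<y}) I"
    unfolding disjoint_family_on_def
  proof (intro ballI impI)
    fix z w assume *: "z \<in> I" "w \<in> I" "z \<noteq> w"
    obtain t K where 1: "(t, K) \<in> p" "z = (Inf K, Sup K)" using *(1) Bp(1) by (auto simp: I_def)
    obtain t' K' where 2: "(t', K') \<in> p" "w = (Inf K', Sup K')" using *(2) Bp(1) by (auto simp: I_def)
    note zw = 1(1) 2(1) 1(2) 2(2)
    then have "(t, K) \<noteq> (t', K')" using * by auto
    then have "interior K \<inter> interior K' = {}" using pD(5) zw by blast
    moreover have "interior K = {Inf K<..<Sup K}" "interior K' = {Inf K'<..<Sup K'}"
      using intK(1) zw(1,2) by blast+
    ultimately show "(\<lambda>(x, y). {x<..<y}) z \<inter> (\<lambda>(x, y). {x<..<y}) w = {}" using zw by auto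
  qed
  moreover have "\<forall>(x, y)\<in>I. x \<le> y \<and> {x..y} \<subseteq> {a..b}"
  proof clarify
    fix x y assume "(x, y) \<in> I"
    then obtain t K where "(t, K) \<in> p" "x = Inf K" "y = Sup K" using Bp by (auto simp: I_def)
    then show "x \<le> y \<and> {x..y} \<subseteq> {a..b}" using intK(3,4)[of t K] by simp
  qed
  ultimately have "(\<Sum>(x, y)\<in>I. norm (u y - u x)) < e" using dI0 Bp by (simp add: I_def)
  then have Bsum: "(\<Sum>(t, K)\<in>B. norm (u (Sup K) - u (Inf K))) < e" by (subst (asm) sumI) auto
  define J where "J = p - B"
  have split: "sum g p = sum g B + sum g J" for g :: "real \<times> real set \<Rightarrow> real"
    unfolding J_def using sum.subset_diff[OF Bp(1) fp] by (simp add: add.commute)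
  have Jp: "t \<in> {a..b} - N" if "(t, K) \<in> J" for t K using that int[of t K] by (auto simp: J_def B_def)
  have "u b - u a - c * (b - a) = (\<Sum>(t, K)\<in>p. (u (Sup K) - c * Sup K) - (u (Inf K) - c * Inf K))"
    by (subst additive_tagged_division_1[OF \<open>a \<le> b\<close> p(1)]) (simp add: algebra_simps)
  also have "\<dots> = (\<Sum>(t, K)\<in>B. (u (Sup K) - u (Inf K)) - c * (Sup K - Inf K))
      + (\<Sum>(t, K)\<in>J. (u (Sup K) - u (Inf K)) - c * (Sup K - Inf K))"
    by (subst split) (simp add: algebra_simps)
  also have "\<dots> \<le> (\<Sum>(t, K)\<in>B. norm (u (Sup K) - u (Inf K)) + \<bar>c\<bar> * (Sup K - Inf K)) + (\<Sum>(t, K)\<in>J. e * (Sup K - Inf K))"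
  proof (intro add_mono sum_mono; clarify)
    fix t K assume "(t, K) \<in> B"
    then have "Inf K \<le> Sup K" using int[of t K] Bp by auto
    then have "- c * (Sup K - Inf K) \<le> \<bar>c\<bar> * (Sup K - Inf K)" by (intro mult_right_mono) auto
    then show "u (Sup K) - u (Inf K) - c * (Sup K - Inf K) \<le> norm (u (Sup K) - u (Inf K)) + \<bar>c\<bar> * (Sup K - Inf K)"
      by simp
  next
    fix t K assume tK: "(t, K) \<in> J"
    then have "(t, K) \<in> p" by (simp add: J_def)
    from int[OF this] have "u (Sup K) - u (Inf K) \<le> (c + e) * (Sup K - Inf K)"
      by (intro rN[OF Jp[OF tK]]) auto
    then show "u (Sup K) - u (Inf K) - c * (Sup K - Inf K) \<le> e * (Sup K - Inf K)" by (simp add: algebra_simps)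
  qed
  also have "\<dots> \<le> (e + e) + e * (b - a)"
  proof (rule add_mono)
    have "(\<Sum>(t, K)\<in>B. norm (u (Sup K) - u (Inf K)) + \<bar>c\<bar> * (Sup K - Inf K))
        = (\<Sum>(t, K)\<in>B. norm (u (Sup K) - u (Inf K))) + \<bar>c\<bar> * (\<Sum>(t, K)\<in>B. Sup K - Inf K)"
      by (simp add: sum.distrib sum_distrib_left case_prod_unfold)
    also have "\<dots> \<le> e + \<bar>c\<bar> * d" using Bsum lenB by (intro add_mono mult_left_mono) auto
    finally show "(\<Sum>(t, K)\<in>B. norm (u (Sup K) - u (Inf K)) + \<bar>c\<bar> * (Sup K - Inf K)) \<le> e + e" using ced by simp
    have "(\<Sum>(t, K)\<in>J. e * (Sup K - Inf K)) \<le> (\<Sum>(t, K)\<in>p. e * (Sup K - Inf K))"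
    proof (intro sum_mono2 fp)
      show "J \<subseteq> p" by (auto simp: J_def)
      fix z assume "z \<in> p - J"
      then obtain t K where "z = (t, K)" "(t, K) \<in> p" by (metis DiffD1 surj_pair)
      then show "0 \<le> (case z of (t, K) \<Rightarrow> e * (Sup K - Inf K))" using e int[of t K] by auto
    qed
    also have "\<dots> = e * (b - a)"
      using additive_tagged_division_1[OF \<open>a \<le> b\<close> p(1), of "\<lambda>x. e * x"] by (simp add: algebra_simps)
    finally show "(\<Sum>(t, K)\<in>J. e * (Sup K - Inf K)) \<le> e * (b - a)" .
  qed
  also have "\<dots> = e * (b - a + 2)" by (simp add: algebra_simps)
  also have "\<dots> = \<epsilon>" using \<open>a \<le> b\<close> by (simp add: e_def)
  finally show "u b - u a \<le> c * (b - a) + \<epsilon>" by simp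
qed

text \<open>Sums of increments of \<open>u\<close> are at most a constant times those of
  \<open>z\<close>, so a \<open>\<delta>\<close> for \<open>z\<close> serves \<open>u\<close>.
  Coordinates of a trajectory and squared distances along it inherit absolute continuity this way.
  Replacing \<open>M\<close> by \<open>\<bar>M\<bar> + 1\<close> makes the constant positive
  whatever the sign of \<open>M\<close>.\<close>

lemma abs_continuous_on_lipschitz:
  fixes z :: "real \<Rightarrow> 'a::real_normed_vector" and u :: "real \<Rightarrow> 'b::real_normed_vector"
  assumes z: "abs_continuous_on T z" and "S \<subseteq> T"
    and lip: "\<And>x y. x \<in> S \<Longrightarrow> y \<in> S \<Longrightarrow> norm (u y - u x) \<le> M * norm (z y - z x)"
  shows "abs_continuous_on S u"
  unfolding abs_continuous_on_def
proof (intro allI impI)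
  fix e :: real assume "e > 0"
  define M' where "M' = \<bar>M\<bar> + 1"
  have M': "M' > 0" "M \<le> M'" by (auto simp: M'_def)
  then have "e / M' > 0" using \<open>e > 0\<close> by simp
  from z[unfolded abs_continuous_on_def, THEN spec, THEN mp, OF this]
  obtain d where d: "d > 0" and dI: "\<forall>I :: (real \<times> real) set. finite I \<longrightarrow>
      (\<forall>(x, y)\<in>I. x \<le> y \<and> {x..y} \<subseteq> T) \<longrightarrow> disjoint_family_on (\<lambda>(x, y). {x<..<y}) I \<longrightarrow>
      (\<Sum>(x, y)\<in>I. y - x) < d \<longrightarrow> (\<Sum>(x, y)\<in>I. norm (z y - z x)) < e / M'"
    by (elim exE conjE)
  show "\<exists>d>0. \<forall>I :: (real \<times> real) set. finite I \<longrightarrow>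
      (\<forall>(x, y)\<in>I. x \<le> y \<and> {x..y} \<subseteq> S) \<longrightarrow> disjoint_family_on (\<lambda>(x, y). {x<..<y}) I \<longrightarrow>
      (\<Sum>(x, y)\<in>I. y - x) < d \<longrightarrow> (\<Sum>(x, y)\<in>I. norm (u y - u x)) < e"
  proof (rule exI[of _ d], intro conjI allI impI d)
    fix I :: "(real \<times> real) set"
    assume I: "finite I" "\<forall>(x, y)\<in>I. x \<le> y \<and> {x..y} \<subseteq> S" "disjoint_family_on (\<lambda>(x, y). {x<..<y}) I"
      "(\<Sum>(x, y)\<in>I. y - x) < d"
    have I2: "\<forall>(x, y)\<in>I. x \<le> y \<and> {x..y} \<subseteq> T" using I(2) \<open>S \<subseteq> T\<close> by blast
    have "(\<Sum>(x, y)\<in>I. norm (u y - u x)) \<le> (\<Sum>(x, y)\<in>I. M' * norm (z y - z x))"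
    proof (intro sum_mono, clarify)
      fix x y assume "(x, y) \<in> I"
      then have "x \<le> y" "{x..y} \<subseteq> S" using I(2) by auto
      then have "x \<in> S" "y \<in> S" by auto
      then have "norm (u y - u x) \<le> M * norm (z y - z x)" by (rule lip)
      also have "\<dots> \<le> M' * norm (z y - z x)" using M' by (intro mult_right_mono) auto
      finally show "norm (u y - u x) \<le> M' * norm (z y - z x)" .
    qed
    also have "\<dots> = M' * (\<Sum>(x, y)\<in>I. norm (z y - z x))"
      by (simp add: sum_distrib_left case_prod_unfold)
    also have "\<dots> < M' * (e / M')"
      using dI[THEN spec, THEN mp, THEN mp, THEN mp, THEN mp, OF I(1) I2 I(3,4)] M'(1) by (rule mult_strict_left_mono)
    also have "\<dots> = e" using M' by simp
    finally show "(\<Sum>(x, y)\<in>I. norm (u y - u x)) < e" .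
  qed
qed

lemma abs_continuous_on_subset:
  fixes z :: "real \<Rightarrow> 'a::real_normed_vector"
  shows "abs_continuous_on T z \<Longrightarrow> S \<subseteq> T \<Longrightarrow> abs_continuous_on S z"
  by (erule abs_continuous_on_lipschitz[where M = 1]) auto

lemma abs_continuous_on_imp_continuous_on:
  fixes z :: "real \<Rightarrow> 'a::real_normed_vector"
  assumes z: "abs_continuous_on {a..b} z"
  shows "continuous_on {a..b} z"
  unfolding continuous_on_iff
proof (intro ballI allI impI)
  fix x e :: real assume x: "x \<in> {a..b}" and "e > 0"
  from z[unfolded abs_continuous_on_def, THEN spec, THEN mp, OF \<open>e > 0\<close>]
  obtain d where d: "d > 0" and dI: "\<forall>I :: (real \<times> real) set. finite I \<longrightarrow>
      (\<forall>(x, y)\<in>I. x \<le> y \<and> {x..y} \<subseteq> {a..b}) \<longrightarrow> disjoint_family_on (\<lambda>(x, y). {x<..<y}) I \<longrightarrow>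
      (\<Sum>(x, y)\<in>I. y - x) < d \<longrightarrow> (\<Sum>(x, y)\<in>I. norm (z y - z x)) < e"
    by (elim exE conjE)
  have *: "norm (z r - z q) < e" if "q \<in> {a..b}" "r \<in> {a..b}" "q \<le> r" "r - q < d" for q r
    using dI[THEN spec, of "{(q, r)}"] that by (auto simp: disjoint_family_on_def)
  show "\<exists>d>0. \<forall>y\<in>{a..b}. dist y x < d \<longrightarrow> dist (z y) (z x) < e"
  proof (rule exI[of _ d], intro conjI ballI impI d)
    fix y assume "y \<in> {a..b}" "dist y x < d"
    then show "dist (z y) (z x) < e"
      using *[of x y] *[of y x] x by (cases "x \<le> y") (auto simp: dist_norm norm_minus_commute)
  qed
qed

text \<open>The endpoints join the exceptional null set, so only two-sided derivatives at interior
  points have to be controlled, which is what the definition of a trajectory supplies.\<close>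

lemma AE_derivative_bound:
  fixes u :: "real \<Rightarrow> real"
  assumes ab: "0 \<le> a" "a \<le> b" and ac: "abs_continuous_on {0..b} u"
    and der: "AE t in lebesgue. a < t \<longrightarrow> t < b \<longrightarrow> (\<exists>d\<le>c. (u has_real_derivative d) (at t))"
  shows "u b - u a \<le> c * (b - a)"
proof -
  obtain N where N: "N \<in> null_sets lebesgue"
    "\<And>t. t \<in> space lebesgue - N \<Longrightarrow> a < t \<longrightarrow> t < b \<longrightarrow> (\<exists>d\<le>c. (u has_real_derivative d) (at t))"
    by (rule AE_E3[OF der]) blast
  have "negligible (N \<union> {a, b})" using N(1) by (simp add: negligible_iff_null_sets[symmetric])
  show ?thesis
  proof (rule abs_continuous_derivative_bound[OF ab(2) abs_continuous_on_subset[OF ac] \<open>negligible (N \<union> {a, b})\<close>])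
    fix t assume "t \<in> {a..b} - (N \<union> {a, b})"
    then have "t \<in> space lebesgue - N" "a < t" "t < b" by (auto simp: less_le)
    with N(2) obtain d where "d \<le> c" "(u has_real_derivative d) (at t)" by blast
    then show "\<exists>d\<le>c. (u has_real_derivative d) (at t within {a..b})"
      by (intro exI[of _ d]) (auto intro: has_field_derivative_at_within)
  qed (use ab in auto)
qed

text \<open>A one-sided Barbalat lemma. If \<open>g t \<ge> e\<close> at a late time, uniform
  continuity keeps \<open>g\<close> above \<open>e/2\<close> on a window of fixed length
  \<open>\<tau>\<close> after it, and \<open>u\<close> drops by at least \<open>e/2 * \<tau>\<close>
  there. Convergence of \<open>u\<close> excludes such drops from some time on.\<close>

lemma barbalat_AE:
  fixes u g :: "real \<Rightarrow> real"
  assumes ac: "\<And>T. T \<ge> 0 \<Longrightarrow> abs_continuous_on {0..T} u"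
    and der: "AE t in lebesgue. t > 0 \<longrightarrow> (\<exists>d\<le>- g t. (u has_real_derivative d) (at t))"
    and g: "uniformly_continuous_on {0..} g"
    and lim: "(u \<longlongrightarrow> l) at_top" and e: "e > 0"
  shows "eventually (\<lambda>t. g t < e) at_top"
proof -
  obtain \<delta> where \<delta>0: "\<delta> > 0"
    and \<delta>1: "\<forall>x\<in>{0..}. \<forall>y\<in>{0..}. dist y x < \<delta> \<longrightarrow> dist (g y) (g x) < e/2"
    using g[unfolded uniformly_continuous_on_def, THEN spec, THEN mp, OF half_gt_zero[OF e]] by (elim exE conjE)
  note \<delta> = \<delta>0 \<delta>1[THEN bspec, THEN bspec, THEN mp]
  define \<tau> where "\<tau> = \<delta>/2"
  have \<tau>: "\<tau> > 0" "\<tau> < \<delta>" using \<delta> by (auto simp: \<tau>_def)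
  have "filterlim (\<lambda>t. t + \<tau>) at_top at_top"
    by (rule filterlim_at_top_mono[OF filterlim_ident]) (use \<tau> in simp)
  from tendsto_diff[OF filterlim_compose[OF lim this] lim]
  have "((\<lambda>t. u (t + \<tau>) - u t) \<longlongrightarrow> l - l) at_top" .
  then have "eventually (\<lambda>t. u (t + \<tau>) - u t > - (e/2 * \<tau>)) at_top"
    using e \<tau> by (intro order_tendstoD(1)) auto
  then show ?thesis
    using eventually_ge_at_top[of 0]
  proof eventually_elim
    case (elim t)
    show "g t < e"
    proof (rule ccontr)
      assume "\<not> g t < e"
      then have gt: "g r > e/2" if "t < r" "r < t + \<tau>" for r
      proof -
        have "dist (g r) (g t) < e/2" using that elim(2) \<tau> by (intro \<delta>(2)) (auto simp: dist_real_def)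
        then have "g t - g r < e/2" unfolding dist_real_def by linarith
        then show ?thesis using \<open>\<not> g t < e\<close> by linarith
      qed
      have "u (t + \<tau>) - u t \<le> - (e/2) * (t + \<tau> - t)"
      proof (rule AE_derivative_bound)
        show "AE r in lebesgue. t < r \<longrightarrow> r < t + \<tau> \<longrightarrow> (\<exists>d\<le>- (e/2). (u has_real_derivative d) (at r))"
          using der
        proof eventually_elim
          case (elim r)
          show ?case
          proof (intro impI)
            assume r: "t < r" "r < t + \<tau>"
            then obtain d where "d \<le> - g r" "(u has_real_derivative d) (at r)" using elim \<open>0 \<le> t\<close> by auto
            then show "\<exists>d\<le>- (e/2). (u has_real_derivative d) (at r)" using gt[OF r] by (intro exI[of _ d]) auto
          qed
        qed
        show "0 \<le> t" "t \<le> t + \<tau>" "abs_continuous_on {0..t + \<tau>} u" using elim(2) \<tau> ac[of "t + \<tau>"] by auto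
      qed
      then show False using elim(1) by simp
    qed
  qed
qed

text \<open>Pairing \<open>z\<close> with the fixed vector \<open>z b - z a\<close> reduces this to
  the scalar bound, and Cauchy-Schwarz leaves a factor \<open>norm (z b - z a)\<close> on both sides
  to cancel.\<close>

lemma AE_vector_derivative_lipschitz:
  fixes z :: "real \<Rightarrow> 'a::real_inner"
  assumes ab: "0 \<le> a" "a \<le> b" and "M \<ge> 0" and ac: "abs_continuous_on {0..b} z"
    and der: "AE t in lebesgue. a < t \<longrightarrow> t < b \<longrightarrow> (\<exists>d. (z has_vector_derivative d) (at t) \<and> norm d \<le> M)"
  shows "norm (z b - z a) \<le> M * (b - a)"
proof -
  define e where "e = z b - z a"
  have "z b \<bullet> e - z a \<bullet> e \<le> (M * norm e) * (b - a)"
  proof (rule AE_derivative_bound[OF ab])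
    show "abs_continuous_on {0..b} (\<lambda>t. z t \<bullet> e)"
    proof (rule abs_continuous_on_lipschitz[OF ac order_refl, where M = "norm e"])
      fix x y
      show "norm (z y \<bullet> e - z x \<bullet> e) \<le> norm e * norm (z y - z x)"
        using Cauchy_Schwarz_ineq2[of "z y - z x" e] by (simp add: inner_diff_left mult.commute)
    qed
    show "AE t in lebesgue. a < t \<longrightarrow> t < b \<longrightarrow> (\<exists>d\<le>M * norm e. ((\<lambda>t. z t \<bullet> e) has_real_derivative d) (at t))"
      using der
    proof eventually_elim
      case (elim t)
      show ?case
      proof (intro impI)
        assume "a < t" "t < b"
        then obtain d where d: "(z has_vector_derivative d) (at t)" "norm d \<le> M" using elim by auto
        have "((\<lambda>t. z t \<bullet> e) has_real_derivative d \<bullet> e) (at t)"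
          using bounded_linear.has_vector_derivative[OF bounded_linear_inner_left d(1)]
          by (simp add: has_real_derivative_iff_has_vector_derivative)
        moreover have "d \<bullet> e \<le> M * norm e"
          using norm_cauchy_schwarz[of d e] d(2) mult_right_mono[OF d(2) norm_ge_zero[of e]] by linarith
        ultimately show "\<exists>d\<le>M * norm e. ((\<lambda>t. z t \<bullet> e) has_real_derivative d) (at t)" by blast
      qed
    qed
  qed
  then have *: "norm e * norm e \<le> norm e * (M * (b - a))"
    by (simp add: e_def inner_diff_left[symmetric] power2_norm_eq_inner[symmetric] power2_eq_square mult_ac)
  then show ?thesis using \<open>M \<ge> 0\<close> ab by (cases "norm e = 0") (auto simp: e_def)
qed

text \<open>A nonempty open interval is not a null set. This turns almost-everywhere membership in a
  closed set into membership at every time, by continuity.\<close>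

lemma AE_imp_ex_between:
  fixes a b :: real
  assumes "AE t in lebesgue. P t" "a < b"
  shows "\<exists>t. a < t \<and> t < b \<and> P t"
proof (rule ccontr)
  assume none: "\<not> (\<exists>t. a < t \<and> t < b \<and> P t)"
  obtain N where N: "N \<in> null_sets lebesgue" "\<And>t. t \<in> space lebesgue - N \<Longrightarrow> P t"
    by (rule AE_E3[OF assms(1)]) blast
  have "{a<..<b} \<subseteq> N"
  proof
    fix t assume "t \<in> {a<..<b}"
    then have "\<not> P t" using none by auto
    then show "t \<in> N" using N(2)[of t] by auto
  qed
  then have "negligible {a<..<b}" using N(1) negligible_subset by (auto simp: negligible_iff_null_sets)
  then show False using open_not_negligible[of "{a<..<b}"] assms(2) by auto
qed

section \<open>The projected direction\<close>

text \<open>If the difference quotient converges, then multiplied by \<delta> it tends to 0, so the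
  projections, which lie in \<open>C\<close>, tend to \<open>y\<close>. Existence of a projected
  direction thus already certifies that its base point is feasible.\<close>

lemma proj_direction_in:
  fixes C :: "'a::euclidean_space set"
  assumes "closed C" "C \<noteq> {}" and p: "proj_direction C y w p"
  shows "y \<in> C"
proof -
  have "((\<lambda>\<delta>. \<delta> *\<^sub>R ((1 / \<delta>) *\<^sub>R (closest_point C (y + \<delta> *\<^sub>R w) - y)) + y) \<longlongrightarrow> 0 *\<^sub>R p + y) (at_right 0)"
    using p unfolding proj_direction_def by (intro tendsto_intros) auto
  then have "((\<lambda>\<delta>. closest_point C (y + \<delta> *\<^sub>R w)) \<longlongrightarrow> y) (at_right 0)"
    by (simp, elim Lim_transform_eventually) (auto simp: eventually_at_filter)
  then show ?thesis
    by (rule Lim_in_closed_set[OF \<open>closed C\<close>, rotated 2])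
       (auto intro!: always_eventually closest_point_in_set assms)
qed

text \<open>The obtuse-angle inequality of the projection of
  \<open>y + \<delta> *\<^sub>R w\<close>, tested against \<open>c\<close> and divided by \<delta>,
  passes to the limit \<delta> to 0.\<close>

lemma proj_direction_variational:
  fixes C :: "'a::euclidean_space set"
  assumes C: "closed C" "convex C" "c \<in> C" and p: "proj_direction C y w p"
  shows "p \<bullet> (y - c) \<le> w \<bullet> (y - c)"
proof -
  define P where "P \<delta> = closest_point C (y + \<delta> *\<^sub>R w)" for \<delta>
  define s where "s \<delta> = (1 / \<delta>) *\<^sub>R (P \<delta> - y)" for \<delta>
  have s: "(s \<longlongrightarrow> p) (at_right 0)" using p by (simp add: proj_direction_def s_def[abs_def] P_def)
  have "((\<lambda>\<delta>. (w - s \<delta>) \<bullet> (c - (y + \<delta> *\<^sub>R s \<delta>))) \<longlongrightarrow> (w - p) \<bullet> (c - (y + 0 *\<^sub>R p))) (at_right 0)"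
    by (intro tendsto_intros s)
  moreover have "eventually (\<lambda>\<delta>. (w - s \<delta>) \<bullet> (c - (y + \<delta> *\<^sub>R s \<delta>)) \<le> 0) (at_right (0::real))"
    using eventually_at_right_less[of 0]
  proof eventually_elim
    case (elim \<delta>)
    have "(y + \<delta> *\<^sub>R w - P \<delta>) \<bullet> (c - P \<delta>) \<le> 0" unfolding P_def by (rule closest_point_dot[OF C(2,1,3)])
    moreover have P: "P \<delta> = y + \<delta> *\<^sub>R s \<delta>" using elim by (simp add: s_def)
    ultimately have "\<delta> * ((w - s \<delta>) \<bullet> (c - (y + \<delta> *\<^sub>R s \<delta>))) \<le> 0"
      by (simp add: inner_diff_left inner_diff_right algebra_simps)
    then show ?case using elim by (simp add: mult_le_0_iff)
  qed
  ultimately have "(w - p) \<bullet> (c - (y + 0 *\<^sub>R p)) \<le> 0"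
    by (intro tendsto_upperbound) auto
  then show ?thesis by (simp add: inner_diff_left inner_diff_right)
qed

text \<open>The projection is nonexpansive and fixes \<open>y\<close>, so every difference quotient
  already has norm at most \<open>norm w\<close>.\<close>

lemma proj_direction_norm_le:
  fixes C :: "'a::euclidean_space set"
  assumes C: "closed C" "convex C" "C \<noteq> {}" and p: "proj_direction C y w p"
  shows "norm p \<le> norm w"
proof (rule tendsto_upperbound)
  have y: "y \<in> C" by (rule proj_direction_in[OF C(1,3) p])
  show "((\<lambda>\<delta>. norm ((1 / \<delta>) *\<^sub>R (closest_point C (y + \<delta> *\<^sub>R w) - y))) \<longlongrightarrow> norm p) (at_right 0)"
    using p unfolding proj_direction_def by (rule tendsto_norm)
  show "eventually (\<lambda>\<delta>. norm ((1 / \<delta>) *\<^sub>R (closest_point C (y + \<delta> *\<^sub>R w) - y)) \<le> norm w) (at_right (0::real))"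
    using eventually_at_right_less[of 0]
  proof eventually_elim
    case (elim \<delta>)
    have "norm (closest_point C (y + \<delta> *\<^sub>R w) - y) \<le> norm (\<delta> *\<^sub>R w)"
      using closest_point_lipschitz[OF C(2,1,3), of "y + \<delta> *\<^sub>R w" y] y
      by (simp add: closest_point_self dist_norm)
    moreover have "norm ((1 / \<delta>) *\<^sub>R (closest_point C (y + \<delta> *\<^sub>R w) - y)) = norm (closest_point C (y + \<delta> *\<^sub>R w) - y) / \<delta>"
      using elim by (simp del: scaleR_diff_right)
    ultimately show ?case using elim by (simp add: divide_le_eq mult.commute)
  qed
qed simp

section \<open>Saddle-point flows\<close>

lemma tendsto_Inf_at_top:
  fixes V :: "real \<Rightarrow> real"
  assumes mono: "\<And>x y. 0 \<le> x \<Longrightarrow> x \<le> y \<Longrightarrow> V y \<le> V x" and nonneg: "\<And>x. 0 \<le> x \<Longrightarrow> 0 \<le> V x"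
  shows "(V \<longlongrightarrow> Inf (V ` {0..})) at_top"
proof (rule order_tendstoI)
  have bdd: "bdd_below (V ` {0..})" using nonneg by (auto intro!: bdd_belowI[of _ 0])
  fix c assume c: "c < Inf (V ` {0..})"
  show "eventually (\<lambda>x. c < V x) at_top"
    using eventually_ge_at_top[of 0]
  proof eventually_elim
    case (elim x)
    then have "Inf (V ` {0..}) \<le> V x" using bdd by (auto intro: cInf_lower)
    then show ?case using c by linarith
  qed
next
  fix c assume "Inf (V ` {0..}) < c"
  then obtain x where x: "x \<ge> 0" "V x < c" using cInf_lessD[of "V ` {0..}" c] by auto
  show "eventually (\<lambda>y. V y < c) at_top"
    using eventually_ge_at_top[of x]
  proof eventually_elim
    case (elim y)
    then show ?case using mono[OF x(1) elim] x(2) by linarith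
  qed
qed

text \<open>The fields \<open>Gp\<close> and \<open>Gq\<close> enter through the gradient
  inequalities alone, not as derivatives of \<open>\<Phi>\<close>. Concavity is required for
  \<open>x \<in> C\<close> only, since in the application concavity in \<xi> comes from the lower
  bound on the multipliers that defines \<open>C\<close>.\<close>

locale saddle_flow =
  fixes \<Phi> :: "'p::euclidean_space \<Rightarrow> 'q::euclidean_space \<Rightarrow> real"
    and Gp :: "'p \<Rightarrow> 'q \<Rightarrow> 'p" and Gq :: "'p \<Rightarrow> 'q \<Rightarrow> 'q" and C :: "'p set"
    and p :: "real \<Rightarrow> 'p" and q :: "real \<Rightarrow> 'q"
  assumes C: "closed C" "convex C"
    and cont_\<Phi>: "continuous_on UNIV (\<lambda>z. \<Phi> (fst z) (snd z))"
    and cont_Gp: "continuous_on UNIV (\<lambda>z. Gp (fst z) (snd z))"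
    and cont_Gq: "continuous_on UNIV (\<lambda>z. Gq (fst z) (snd z))"
    and convex: "\<And>x x' y. x \<in> C \<Longrightarrow> x' \<in> C \<Longrightarrow> \<Phi> x y + Gp x y \<bullet> (x' - x) \<le> \<Phi> x' y"
    and concave: "\<And>x y y'. x \<in> C \<Longrightarrow> \<Phi> x y' \<le> \<Phi> x y + Gq x y \<bullet> (y' - y)"
    and ac: "\<And>T. T \<ge> 0 \<Longrightarrow> abs_continuous_on {0..T} (\<lambda>t. (p t, q t))"
    and flow: "AE t in lebesgue. t > 0 \<longrightarrow>
        (\<exists>p'. (p has_vector_derivative p') (at t) \<and> proj_direction C (p t) (- Gp (p t) (q t)) p') \<and>
        (q has_vector_derivative Gq (p t) (q t)) (at t)"
    and start: "p 0 \<in> C"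
begin

lemma C_nonempty: "C \<noteq> {}" using start by auto

text \<open>Extracts from the projection exactly what the sequel uses; later arguments about the
  flow no longer mention \<open>proj_direction\<close>.\<close>

lemma flow_variational:
  "AE t in lebesgue. t > 0 \<longrightarrow> (\<exists>p'. (p has_vector_derivative p') (at t) \<and> p t \<in> C \<and>
     norm p' \<le> norm (Gp (p t) (q t)) \<and> (\<forall>a\<in>C. p' \<bullet> (p t - a) \<le> - Gp (p t) (q t) \<bullet> (p t - a))) \<and>
     (q has_vector_derivative Gq (p t) (q t)) (at t)"
  using flow
proof eventually_elim
  case (elim t)
  show ?case
  proof
    assume "t > 0"
    with elim obtain p' where p': "(p has_vector_derivative p') (at t)"
      "proj_direction C (p t) (- Gp (p t) (q t)) p'" "(q has_vector_derivative Gq (p t) (q t)) (at t)" by blast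
    show "(\<exists>p'. (p has_vector_derivative p') (at t) \<and> p t \<in> C \<and>
       norm p' \<le> norm (Gp (p t) (q t)) \<and> (\<forall>a\<in>C. p' \<bullet> (p t - a) \<le> - Gp (p t) (q t) \<bullet> (p t - a))) \<and>
       (q has_vector_derivative Gq (p t) (q t)) (at t)"
      using p' proj_direction_in[OF C(1) C_nonempty p'(2)] proj_direction_norm_le[OF C C_nonempty p'(2)]
        proj_direction_variational[OF C _ p'(2)]
      by (intro conjI exI[of _ p']) auto
  qed
qed

lemma continuous_pq: "T \<ge> 0 \<Longrightarrow> continuous_on {0..T} (\<lambda>t. (p t, q t))"
  by (rule abs_continuous_on_imp_continuous_on[OF ac])

lemma continuous_p: "T \<ge> 0 \<Longrightarrow> continuous_on {0..T} p"
  using continuous_on_fst[OF continuous_pq] by simp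

text \<open>At almost every time feasibility holds because the projected direction exists. A point
  outside the closed set would, by continuity, keep the trajectory outside on an interval to its
  right, which contains such a time.\<close>

lemma p_in_C:
  assumes "t \<ge> 0" shows "p t \<in> C"
proof (rule ccontr)
  assume "p t \<notin> C"
  then obtain e where e: "e > 0" "ball (p t) e \<subseteq> - C"
    using C(1) by (metis ComplI open_Compl openE)
  have "continuous_on {0..t + 1} p" using continuous_p assms by simp
  from this[unfolded continuous_on_iff, THEN bspec, of t, THEN spec, THEN mp, OF _ e(1)]
  obtain d where d: "d > 0" "\<forall>r\<in>{0..t + 1}. dist r t < d \<longrightarrow> dist (p r) (p t) < e"
    using assms by auto
  have "AE r in lebesgue. r > 0 \<longrightarrow> p r \<in> C" using flow_variational by (elim eventually_mono) blast
  from AE_imp_ex_between[OF this, of t "t + min d 1"]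
  obtain r where r: "t < r" "r < t + min d 1" "r > 0 \<longrightarrow> p r \<in> C" using d(1) by auto
  then have "dist (p r) (p t) < e" using d(2) assms by (auto simp: dist_real_def)
  then have "p r \<notin> C" using e(2) by (auto simp: dist_commute subset_iff)
  then show False using r assms by auto
qed

text \<open>The primal half is kept separate because it serves alone in
  \<open>saddle_limit_point\<close>, with a competitor \<open>a\<close> that belongs to no saddle
  point.\<close>

definition "Vp a t = (p t - a) \<bullet> (p t - a) / 2"
definition "Vq b t = (q t - b) \<bullet> (q t - b) / 2"

text \<open>On a compact time interval the trajectory is bounded, and the squared distance is
  Lipschitz on bounded sets because
  \<open>u \<bullet> u - v \<bullet> v = (u - v) \<bullet> (u + v)\<close>.\<close>

lemma Vp_ac: "T \<ge> 0 \<Longrightarrow> abs_continuous_on {0..T} (Vp a)"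
  and V_ac: "T \<ge> 0 \<Longrightarrow> abs_continuous_on {0..T} (\<lambda>t. Vp a t + Vq b t)"
proof -
  assume T: "T \<ge> 0"
  have "compact ((\<lambda>t. (p t, q t)) ` {0..T})"
    by (rule compact_continuous_image[OF continuous_pq[OF T] compact_Icc])
  then obtain B where B: "\<And>t. t \<in> {0..T} \<Longrightarrow> norm (p t, q t) \<le> B"
    by (meson bounded_iff compact_imp_bounded imageI)
  have key: "norm ((x - c) \<bullet> (x - c) / 2 - (y - c) \<bullet> (y - c) / 2) \<le> (B + norm c) * n"
    if xy: "norm x \<le> B" "norm y \<le> B" "norm (x - y) \<le> n" for x y c :: "'e::real_inner" and n
  proof -
    define u v where "u = x - c" and "v = y - c"
    have uv: "norm (u + v) \<le> 2 * (B + norm c)" "norm (u - v) \<le> n"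
      using norm_triangle_ineq[of u v] norm_triangle_ineq4[of x c] norm_triangle_ineq4[of y c] xy
      by (auto simp: u_def v_def)
    have "u \<bullet> u - v \<bullet> v = (u - v) \<bullet> (u + v)"
      by (simp add: inner_diff_left inner_add_right inner_commute[of v u])
    also have "\<bar>\<dots>\<bar> \<le> norm (u - v) * norm (u + v)" by (rule Cauchy_Schwarz_ineq2)
    also have "\<dots> \<le> n * (2 * (B + norm c))" by (intro mult_mono uv order_trans[OF norm_ge_zero uv(2)]) auto
    finally have "\<bar>u \<bullet> u - v \<bullet> v\<bar> \<le> 2 * ((B + norm c) * n)" by (simp add: mult_ac)
    moreover have "\<bar>u \<bullet> u / 2 - v \<bullet> v / 2\<bar> = \<bar>u \<bullet> u - v \<bullet> v\<bar> / 2" by (simp add: diff_divide_distrib[symmetric])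
    ultimately show ?thesis by (simp add: u_def v_def)
  qed
  have Bp: "norm (p t) \<le> B" and Bq: "norm (q t) \<le> B" if "t \<in> {0..T}" for t
    using B[OF that] norm_fst_le[of "p t" "q t"] norm_snd_le[of "q t" "p t"] by auto
  have np: "norm (p y - p x) \<le> norm ((p y, q y) - (p x, q x))"
    and nq: "norm (q y - q x) \<le> norm ((p y, q y) - (p x, q x))" for x y
    using norm_fst_le[of "p y - p x" "q y - q x"] norm_snd_le[of "q y - q x" "p y - p x"] by auto
  have lp: "norm (Vp a y - Vp a x) \<le> (B + norm a) * norm ((p y, q y) - (p x, q x))"
    and lq: "norm (Vq b y - Vq b x) \<le> (B + norm b) * norm ((p y, q y) - (p x, q x))"
    if "x \<in> {0..T}" "y \<in> {0..T}" for x y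
    unfolding Vp_def Vq_def using key[OF Bp Bp np] key[OF Bq Bq nq] that by blast+
  show "abs_continuous_on {0..T} (Vp a)"
    using abs_continuous_on_lipschitz[OF ac[OF T] order_refl lp] by blast
  show "abs_continuous_on {0..T} (\<lambda>t. Vp a t + Vq b t)"
  proof (rule abs_continuous_on_lipschitz[OF ac[OF T] order_refl])
    fix x y assume "x \<in> {0..T}" "y \<in> {0..T}"
    from lp[OF this] lq[OF this]
    show "norm (Vp a y + Vq b y - (Vp a x + Vq b x)) \<le> ((B + norm a) + (B + norm b)) * norm ((p y, q y) - (p x, q x))"
      using norm_triangle_ineq[of "Vp a y - Vp a x" "Vq b y - Vq b x"] by (simp add: algebra_simps)
  qed
qed

lemma Vp_derivative:
  "AE t in lebesgue. t > 0 \<longrightarrow> (\<forall>a\<in>C. \<exists>d \<le> - Gp (p t) (q t) \<bullet> (p t - a). (Vp a has_real_derivative d) (at t))"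
  using flow_variational
proof eventually_elim
  case (elim t)
  show ?case
  proof (intro impI ballI)
    fix a assume "t > 0" "a \<in> C"
    then obtain p' where p': "(p has_vector_derivative p') (at t)" "p' \<bullet> (p t - a) \<le> - Gp (p t) (q t) \<bullet> (p t - a)"
      using elim by blast
    have "(Vp a has_real_derivative p' \<bullet> (p t - a)) (at t)"
      unfolding Vp_def[abs_def] has_field_derivative_def using p'(1)[unfolded has_vector_derivative_def]
      by (auto intro!: derivative_eq_intros simp: inner_commute)
    then show "\<exists>d \<le> - Gp (p t) (q t) \<bullet> (p t - a). (Vp a has_real_derivative d) (at t)" using p'(2) by blast
  qed
qed

lemma Vq_derivative:
  "AE t in lebesgue. t > 0 \<longrightarrow> (Vq b has_real_derivative Gq (p t) (q t) \<bullet> (q t - b)) (at t)"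
  using flow_variational
proof eventually_elim
  case (elim t)
  show ?case
  proof
    assume "t > 0"
    then have "(q has_vector_derivative Gq (p t) (q t)) (at t)" using elim by blast
    then show "(Vq b has_real_derivative Gq (p t) (q t) \<bullet> (q t - b)) (at t)"
      unfolding Vq_def[abs_def] has_field_derivative_def has_vector_derivative_def
      by (auto intro!: derivative_eq_intros simp: inner_commute)
  qed
qed

text \<open>The pairing of the monotone saddle operator \<open>(Gp, - Gq)\<close> at
  \<open>(x, y)\<close> with the displacement from \<open>(a, b)\<close>.\<close>

definition "dissipation a b x y = Gp x y \<bullet> (x - a) - Gq x y \<bullet> (y - b)"

lemma V_derivative:
  assumes "a \<in> C"
  shows "AE t in lebesgue. t > 0 \<longrightarrow>
    (\<exists>d \<le> - dissipation a b (p t) (q t). ((\<lambda>t. Vp a t + Vq b t) has_real_derivative d) (at t))"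
  using Vp_derivative Vq_derivative[of b]
proof eventually_elim
  case (elim t)
  show ?case
  proof
    assume "t > 0"
    then obtain d where d: "d \<le> - Gp (p t) (q t) \<bullet> (p t - a)" "(Vp a has_real_derivative d) (at t)"
      using elim(1) assms by blast
    have "((\<lambda>t. Vp a t + Vq b t) has_real_derivative (d + Gq (p t) (q t) \<bullet> (q t - b))) (at t)"
      using d(2) elim(2) \<open>t > 0\<close> by (intro DERIV_add) auto
    then show "\<exists>d \<le> - dissipation a b (p t) (q t). ((\<lambda>t. Vp a t + Vq b t) has_real_derivative d) (at t)"
      using d(1) by (intro exI[of _ "d + Gq (p t) (q t) \<bullet> (q t - b)"]) (auto simp: dissipation_def)
  qed
qed

text \<open>Adding the convexity inequality in the first argument and the concavity inequality in
  the second cancels \<open>\<Phi> x y\<close>.\<close>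

lemma dissipation_ge:
  assumes "a \<in> C" "x \<in> C"
  shows "\<Phi> x b - \<Phi> a y \<le> dissipation a b x y"
  using convex[OF assms(2,1), of y] concave[OF assms(2), of b y]
  by (simp add: dissipation_def inner_diff_right)

lemma dissipation_nonneg:
  assumes "saddle_point \<Phi> C UNIV a b" "x \<in> C"
  shows "0 \<le> dissipation a b x y"
proof -
  have "a \<in> C" "\<Phi> a y \<le> \<Phi> a b" "\<Phi> a b \<le> \<Phi> x b" using assms unfolding saddle_point_def by auto
  then show ?thesis using dissipation_ge[of a x b y] assms(2) by linarith
qed

text \<open>Fejer monotonicity. It is stated for an arbitrary saddle point because it is applied
  twice: to the given one for boundedness, and to the limit point for convergence.\<close>

lemma V_decreasing:
  assumes s: "saddle_point \<Phi> C UNIV a b" and t: "0 \<le> t" "t \<le> t'"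
  shows "Vp a t' + Vq b t' \<le> Vp a t + Vq b t"
proof -
  have aC: "a \<in> C" using s by (simp add: saddle_point_def)
  have "Vp a t' + Vq b t' - (Vp a t + Vq b t) \<le> 0 * (t' - t)"
  proof (rule AE_derivative_bound[OF t V_ac])
    show "AE r in lebesgue. t < r \<longrightarrow> r < t' \<longrightarrow> (\<exists>d\<le>0. ((\<lambda>t. Vp a t + Vq b t) has_real_derivative d) (at r))"
      using V_derivative[OF aC, of b]
    proof eventually_elim
      case (elim r)
      show ?case
      proof (intro impI)
        assume "t < r"
        then obtain d where "d \<le> - dissipation a b (p r) (q r)" "((\<lambda>t. Vp a t + Vq b t) has_real_derivative d) (at r)"
          using elim t by auto
        moreover have "0 \<le> dissipation a b (p r) (q r)"
          using \<open>t < r\<close> t by (intro dissipation_nonneg[OF s] p_in_C) auto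
        ultimately show "\<exists>d\<le>0. ((\<lambda>t. Vp a t + Vq b t) has_real_derivative d) (at r)" by (intro exI[of _ d]) auto
      qed
    qed
  qed (use t in auto)
  then show ?thesis by simp
qed

end

section \<open>Convergence of a saddle-point flow to a saddle point\<close>

text \<open>The second assumption says that every coordinate of \<open>q\<close> either is determined or has zero velocity
  wherever the dissipation vanishes.\<close>
locale convergent_saddle_flow = saddle_flow +
  fixes a b
  assumes saddle: "saddle_point \<Phi> C UNIV a b"
    and zero_dissipation: "\<And>e. e \<in> Basis \<Longrightarrow>
      (\<forall>x\<in>C. \<forall>y. dissipation a b x y = 0 \<longrightarrow> y \<bullet> e = b \<bullet> e) \<or>
      (\<forall>x\<in>C. \<forall>y. dissipation a b x y = 0 \<longrightarrow> Gq x y \<bullet> e = 0)"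
begin

lemma a_in_C: "a \<in> C" using saddle by (simp add: saddle_point_def)

lemma bounded_trajectory: obtains B where "\<And>t. t \<ge> 0 \<Longrightarrow> norm (p t, q t) \<le> B"
proof
  fix t :: real assume t: "t \<ge> 0"
  define W where "W = Vp a 0 + Vq b 0"
  have "(norm (p t - a, q t - b))\<^sup>2 = 2 * (Vp a t + Vq b t)"
    unfolding power2_norm_eq_inner by (simp add: Vp_def Vq_def)
  also have "\<dots> \<le> 2 * W" using V_decreasing[OF saddle order_refl t] by (simp add: W_def)
  finally have "norm (p t - a, q t - b) \<le> sqrt (2 * W)" by (rule real_le_rsqrt)
  moreover have "(p t, q t) = (p t - a, q t - b) + (a, b)" by simp
  ultimately show "norm (p t, q t) \<le> sqrt (2 * W) + norm (a, b)"
    using norm_triangle_ineq[of "(p t - a, q t - b)" "(a, b)"] by simp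
qed

text \<open>The continuous fields are bounded on the ball containing the trajectory, and projecting
  does not lengthen a velocity. Hence the trajectory is Lipschitz although its velocity may
  jump.\<close>

lemma velocity_bound:
  obtains M where "M \<ge> 0" "\<And>t t'. 0 \<le> t \<Longrightarrow> t \<le> t' \<Longrightarrow> norm ((p t', q t') - (p t, q t)) \<le> M * (t' - t)"
proof -
  obtain B where B: "\<And>t. t \<ge> 0 \<Longrightarrow> norm (p t, q t) \<le> B" using bounded_trajectory by blast
  define H where "H z = norm (Gp (fst z) (snd z)) + norm (Gq (fst z) (snd z))" for z
  have "continuous_on (cball 0 B) H" unfolding H_def
    by (intro continuous_intros continuous_on_subset[OF cont_Gp] continuous_on_subset[OF cont_Gq]) auto
  then have "bounded (H ` cball 0 B)" by (intro compact_imp_bounded compact_continuous_image) auto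
  then obtain M where M: "\<And>z. z \<in> cball 0 B \<Longrightarrow> norm (H z) \<le> M" by (meson bounded_iff imageI)
  have M0: "M \<ge> 0" using M[of "(p 0, q 0)"] B[of 0] by (auto intro: order_trans[OF norm_ge_zero])
  show thesis
  proof (rule that[OF M0])
    fix t t' :: real assume t: "0 \<le> t" "t \<le> t'"
    show "norm ((p t', q t') - (p t, q t)) \<le> M * (t' - t)"
    proof (rule AE_vector_derivative_lipschitz[OF t M0 ac])
      show "AE r in lebesgue. t < r \<longrightarrow> r < t' \<longrightarrow> (\<exists>d. ((\<lambda>t. (p t, q t)) has_vector_derivative d) (at r) \<and> norm d \<le> M)"
        using flow_variational
      proof eventually_elim
        case (elim r)
        show ?case
        proof (intro impI)
          assume "t < r"
          then have "r > 0" using \<open>0 \<le> t\<close> by simp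
          then obtain p' where p': "(p has_vector_derivative p') (at r)" "norm p' \<le> norm (Gp (p r) (q r))"
             "(q has_vector_derivative Gq (p r) (q r)) (at r)" using elim by blast
          have "norm (p', Gq (p r) (q r)) \<le> norm p' + norm (Gq (p r) (q r))" by (rule norm_Pair_le)
          also have "\<dots> \<le> norm (H (p r, q r))" using p'(2) by (simp add: H_def)
          also have "\<dots> \<le> M" using \<open>r > 0\<close> by (intro M) (simp add: B)
          finally show "\<exists>d. ((\<lambda>t. (p t, q t)) has_vector_derivative d) (at r) \<and> norm d \<le> M"
            using has_vector_derivative_Pair[OF p'(1,3)] by blast
        qed
      qed
    qed (use t in auto)
  qed
qed

text \<open>A continuous function is uniformly continuous on the compact ball, and the trajectory is
  Lipschitz; this supplies the regularity that \<open>barbalat_AE\<close> asks for.\<close>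

lemma uniformly_continuous_along:
  fixes H :: "'a \<times> 'b \<Rightarrow> real"
  assumes "continuous_on UNIV H"
  shows "uniformly_continuous_on {0..} (\<lambda>t. H (p t, q t))"
proof -
  obtain B where B: "\<And>t. t \<ge> 0 \<Longrightarrow> norm (p t, q t) \<le> B" using bounded_trajectory by blast
  obtain M where M: "M \<ge> 0" "\<And>t t'. 0 \<le> t \<Longrightarrow> t \<le> t' \<Longrightarrow> norm ((p t', q t') - (p t, q t)) \<le> M * (t' - t)"
    using velocity_bound by blast
  have "uniformly_continuous_on (cball 0 B) H"
    by (intro compact_uniformly_continuous continuous_on_subset[OF assms]) auto
  then have H: "uniformly_continuous_on ((\<lambda>t. (p t, q t)) ` {0..}) H"
    using B unfolding uniformly_continuous_on_def by fastforce
  have "M-lipschitz_on {0..} (\<lambda>t. (p t, q t))"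
  proof (rule lipschitz_onI[OF _ M(1)])
    fix x y :: real assume "x \<in> {0..}" "y \<in> {0..}"
    then show "dist (p x, q x) (p y, q y) \<le> M * dist x y"
      using M(2)[of x y, folded dist_norm] M(2)[of y x, folded dist_norm]
      by (cases "x \<le> y") (auto simp: dist_real_def dist_commute[of "(p y, q y)"] simp del: dist_Pair_Pair)
  qed
  then have "uniformly_continuous_on {0..} (\<lambda>t. (p t, q t))" by (rule lipschitz_on_uniformly_continuous)
  from uniformly_continuous_on_compose[OF this H] show ?thesis .
qed

lemma dissipation_continuous: "continuous_on UNIV (\<lambda>z. dissipation a b (fst z) (snd z))"
  unfolding dissipation_def by (intro continuous_intros cont_Gp cont_Gq)

lemma dissipation_tendsto_0: "((\<lambda>t. dissipation a b (p t) (q t)) \<longlongrightarrow> 0) at_top"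
proof -
  have lim: "((\<lambda>t. Vp a t + Vq b t) \<longlongrightarrow> Inf ((\<lambda>t. Vp a t + Vq b t) ` {0..})) at_top"
    by (rule tendsto_Inf_at_top[OF V_decreasing[OF saddle]]) (auto simp: Vp_def Vq_def)
  have "eventually (\<lambda>t. dissipation a b (p t) (q t) < e) at_top" if "e > 0" for e
    by (rule barbalat_AE[OF V_ac V_derivative[OF a_in_C] _ lim that])
      (use uniformly_continuous_along[OF dissipation_continuous] in simp_all)
  moreover have "eventually (\<lambda>t. 0 \<le> dissipation a b (p t) (q t)) at_top"
    using eventually_ge_at_top[of 0] by eventually_elim (intro dissipation_nonneg[OF saddle] p_in_C)
  ultimately show ?thesis by (intro order_tendstoI) (auto elim: eventually_mono)
qed

text \<open>On the compact set of feasible states in the bounding ball with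
  \<open>\<bar>H\<bar> \<ge> e\<close>, the dissipation attains its minimum, which is positive by
  \<open>zero\<close>. Once the dissipation along the trajectory is below that minimum, the
  trajectory has left this set.\<close>

lemma tendsto_0_along:
  fixes H :: "'a \<times> 'b \<Rightarrow> real"
  assumes H: "continuous_on UNIV H"
    and zero: "\<And>x y. x \<in> C \<Longrightarrow> dissipation a b x y = 0 \<Longrightarrow> H (x, y) = 0"
  shows "((\<lambda>t. H (p t, q t)) \<longlongrightarrow> 0) at_top"
proof (rule tendstoI)
  fix e :: real assume e: "e > 0"
  obtain B where B: "\<And>t. t \<ge> 0 \<Longrightarrow> norm (p t, q t) \<le> B" using bounded_trajectory by blast
  define D where "D z = dissipation a b (fst z) (snd z)" for z
  have Dcont: "continuous_on S D" for S
    using dissipation_continuous unfolding D_def by (rule continuous_on_subset) simp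
  define S where "S = cball 0 B \<inter> ((C \<times> UNIV) \<inter> {z. e \<le> \<bar>H z\<bar>})"
  have "compact S" unfolding S_def
    by (intro compact_Int_closed closed_Int closed_Times C closed_Collect_le continuous_intros H) auto
  have zS: "(p t, q t) \<in> S" if "t \<ge> 0" "\<not> \<bar>H (p t, q t)\<bar> < e" for t
    using that B[of t] p_in_C[of t] by (auto simp: S_def)
  show "eventually (\<lambda>t. dist (H (p t, q t)) 0 < e) at_top"
  proof (cases "S = {}")
    case True
    show ?thesis using eventually_ge_at_top[of 0]
    proof eventually_elim
      case (elim t) then show ?case using zS[of t] True by auto
    qed
  next
    case False
    obtain z where z: "z \<in> S" "\<And>w. w \<in> S \<Longrightarrow> D z \<le> D w"
      using continuous_attains_inf[OF \<open>compact S\<close> False Dcont] by blast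
    have "fst z \<in> C" "e \<le> \<bar>H z\<bar>" using z(1) by (auto simp: S_def)
    then have "D z \<noteq> 0" using zero[of "fst z" "snd z"] e by (auto simp: D_def)
    then have "D z > 0" using dissipation_nonneg[OF saddle \<open>fst z \<in> C\<close>, of "snd z"] by (simp add: D_def)
    then have "eventually (\<lambda>t. D (p t, q t) < D z) at_top"
      using order_tendstoD(2)[OF dissipation_tendsto_0] by (simp add: D_def)
    then show ?thesis using eventually_ge_at_top[of 0]
    proof eventually_elim
      case (elim t) then show ?case using zS[of t] z(2)[of "(p t, q t)"] by auto
    qed
  qed
qed

text \<open>Coordinates whose velocity vanishes with the dissipation are settled by
  \<open>tendsto_0_along\<close>. A coordinate pinned by zero dissipation first converges to its
  value in \<open>b\<close>, and its velocity, being uniformly continuous in time, then decays by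
  Barbalat.\<close>

lemma Gq_tendsto_0: "((\<lambda>t. Gq (p t) (q t)) \<longlongrightarrow> 0) at_top"
  unfolding tendsto_componentwise_iff[of _ 0]
proof
  fix e :: 'b assume e: "e \<in> Basis"
  define H where "H z = Gq (fst z) (snd z) \<bullet> e" for z
  have Hcont: "continuous_on UNIV H" unfolding H_def by (intro continuous_intros cont_Gq)
  from zero_dissipation[OF e]
  show "((\<lambda>t. Gq (p t) (q t) \<bullet> e) \<longlongrightarrow> 0 \<bullet> e) at_top"
  proof
    assume "\<forall>x\<in>C. \<forall>y. dissipation a b x y = 0 \<longrightarrow> Gq x y \<bullet> e = 0"
    then show ?thesis using tendsto_0_along[OF Hcont] by (simp add: H_def)
  next
    assume *: "\<forall>x\<in>C. \<forall>y. dissipation a b x y = 0 \<longrightarrow> y \<bullet> e = b \<bullet> e"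
    have "((\<lambda>t. snd (p t, q t) \<bullet> e - b \<bullet> e) \<longlongrightarrow> 0) at_top"
      by (rule tendsto_0_along) (use * in \<open>auto intro!: continuous_intros\<close>)
    then have lim: "((\<lambda>t. q t \<bullet> e) \<longlongrightarrow> b \<bullet> e) at_top" by (simp add: LIM_zero_iff)
    \<comment> \<open>\<open>barbalat_AE\<close> bounds from one side only; the signs
      \<open>c = 1\<close> and \<open>c = - 1\<close> give the lower and the upper bound on the
      velocity of this coordinate.\<close>
    have ace: "abs_continuous_on {0..T} (\<lambda>t. c * (q t \<bullet> e))" if "T \<ge> 0" "\<bar>c\<bar> = 1" for T c :: real
    proof (rule abs_continuous_on_lipschitz[OF ac[OF that(1)] order_refl, where M = 1])
      fix x y
      have "norm (c * (q y \<bullet> e) - c * (q x \<bullet> e)) = \<bar>(q y - q x) \<bullet> e\<bar>"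
        using that(2) by (simp add: right_diff_distrib[symmetric] abs_mult inner_diff_left)
      also have "\<dots> \<le> norm (q y - q x)" using e by (rule Basis_le_norm)
      also have "\<dots> \<le> norm ((p y, q y) - (p x, q x))" using norm_snd_le[of "q y - q x" "p y - p x"] by simp
      finally show "norm (c * (q y \<bullet> e) - c * (q x \<bullet> e)) \<le> 1 * norm ((p y, q y) - (p x, q x))" by simp
    qed
    have ev: "eventually (\<lambda>t. - c * H (p t, q t) < r) at_top" if "r > 0" "\<bar>c\<bar> = 1" for r c
    proof (rule barbalat_AE[OF ace[OF _ that(2)] _ uniformly_continuous_along tendsto_mult_left[OF lim] that(1)])
      show "continuous_on UNIV (\<lambda>z. - c * H z)" by (intro continuous_intros Hcont)
      show "AE t in lebesgue. 0 < t \<longrightarrow> (\<exists>d\<le>- (- c * H (p t, q t)). ((\<lambda>t. c * (q t \<bullet> e)) has_real_derivative d) (at t))"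
        using flow_variational
      proof eventually_elim
        case (elim t)
        show ?case
        proof
          assume "0 < t"
          then have "(q has_vector_derivative Gq (p t) (q t)) (at t)" using elim by blast
          from bounded_linear.has_vector_derivative[OF bounded_linear_inner_left this, of e]
          have "((\<lambda>t. c * (q t \<bullet> e)) has_real_derivative c * (Gq (p t) (q t) \<bullet> e)) (at t)"
            by (intro DERIV_cmult) (simp add: has_real_derivative_iff_has_vector_derivative)
          then show "\<exists>d\<le>- (- c * H (p t, q t)). ((\<lambda>t. c * (q t \<bullet> e)) has_real_derivative d) (at t)"
            by (intro exI) (auto simp: H_def)
        qed
      qed
    qed auto
    have "((\<lambda>t. H (p t, q t)) \<longlongrightarrow> 0) at_top"
    proof (rule order_tendstoI)
      fix r :: real assume "r < 0"
      then show "eventually (\<lambda>t. r < H (p t, q t)) at_top" using ev[of "- r" 1] by simp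
    next
      fix r :: real assume "0 < r"
      then show "eventually (\<lambda>t. H (p t, q t) < r) at_top" using ev[of r "- 1"] by simp
    qed
    then show ?thesis by (simp add: H_def)
  qed
qed

text \<open>Concavity at \<open>p t\<close> gives \<open>\<Phi> (p t) b \<le> \<Phi> (p t) (q t) +
  Gq (p t) (q t) \<bullet> (b - q t)\<close>. The last term vanishes in the limit, as
  \<open>Gq\<close> does and \<open>b - q t\<close> is bounded, and the left side is at least
  \<open>\<Phi> a b\<close>.\<close>

lemma value_lower_bound:
  assumes "e > 0"
  shows "eventually (\<lambda>t. \<Phi> a b - e < \<Phi> (p t) (q t)) at_top"
proof -
  obtain B where B: "\<And>t. t \<ge> 0 \<Longrightarrow> norm (p t, q t) \<le> B" using bounded_trajectory by blast
  define K where "K = norm b + \<bar>B\<bar> + 1"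
  have K: "K > 0" by (simp add: K_def add_nonneg_pos)
  have "eventually (\<lambda>t. norm (Gq (p t) (q t)) < e / K) at_top"
    using tendstoD[OF Gq_tendsto_0, of "e / K"] assms K by simp
  then show ?thesis using eventually_ge_at_top[of 0]
  proof eventually_elim
    case (elim t)
    have pC: "p t \<in> C" using elim by (intro p_in_C)
    have "norm (b - q t) \<le> K"
      using norm_triangle_ineq4[of b "q t"] norm_snd_le[of "q t" "p t"] B[of t] elim by (simp add: K_def)
    then have "\<bar>Gq (p t) (q t) \<bullet> (b - q t)\<bar> \<le> norm (Gq (p t) (q t)) * K"
      using Cauchy_Schwarz_ineq2[of "Gq (p t) (q t)" "b - q t"] 
        mult_left_mono[OF _ norm_ge_zero[of "Gq (p t) (q t)"], of "norm (b - q t)" K] by linarith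
    also have "\<dots> < e" using elim(1) K by (simp add: pos_less_divide_eq)
    finally have "Gq (p t) (q t) \<bullet> (b - q t) < e" by simp
    moreover have "\<Phi> a b \<le> \<Phi> (p t) b" using saddle pC by (auto simp: saddle_point_def)
    ultimately show ?case using concave[OF pC, of b "q t"] by linarith
  qed
qed

lemma saddle_limit_point:
  assumes \<tau>: "filterlim \<tau> at_top sequentially" and lim: "(\<lambda>n. (p (\<tau> n), q (\<tau> n))) \<longlonglongrightarrow> (x\<^sub>0, y\<^sub>0)"
  shows "saddle_point \<Phi> C UNIV x\<^sub>0 y\<^sub>0"
proof -
  have along: "(\<lambda>n. H (p (\<tau> n), q (\<tau> n))) \<longlonglongrightarrow> H (x\<^sub>0, y\<^sub>0)"
    if "continuous_on UNIV H" for H :: "'a \<times> 'b \<Rightarrow> 'c::topological_space"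
    using that lim continuous_on_tendsto_compose[OF that lim] by simp
  have lim_p: "(\<lambda>n. p (\<tau> n)) \<longlonglongrightarrow> x\<^sub>0" and lim_q: "(\<lambda>n. q (\<tau> n)) \<longlonglongrightarrow> y\<^sub>0"
    using tendsto_fst[OF lim] tendsto_snd[OF lim] by auto
  have ev\<tau>: "eventually (\<lambda>n. P (\<tau> n)) sequentially" if "eventually P at_top" for P
    using \<tau> that by (rule eventually_compose_filterlim[rotated])
  have x\<^sub>0: "x\<^sub>0 \<in> C"
  proof (rule Lim_in_closed_set[OF C(1) _ _ lim_p])
    show "eventually (\<lambda>n. p (\<tau> n) \<in> C) sequentially"
      by (rule ev\<tau>, rule eventually_mono[OF eventually_ge_at_top[of 0]]) (rule p_in_C)
  qed simp
  have Gq0: "Gq x\<^sub>0 y\<^sub>0 = 0"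
    using LIMSEQ_unique[OF along[OF cont_Gq, simplified] filterlim_compose[OF Gq_tendsto_0 \<tau>]] .
  have D0: "dissipation a b x\<^sub>0 y\<^sub>0 = 0"
    using LIMSEQ_unique[OF along[OF dissipation_continuous, simplified] filterlim_compose[OF dissipation_tendsto_0 \<tau>]] .
  have max: "\<Phi> x\<^sub>0 y \<le> \<Phi> x\<^sub>0 y\<^sub>0" for y
    using concave[OF x\<^sub>0, of y y\<^sub>0] Gq0 by simp
  \<comment> \<open>With \<open>Gq\<close> zero at the limit point, zero dissipation reads
    \<open>Gp x\<^sub>0 y\<^sub>0 \<bullet> (x\<^sub>0 - a) = 0\<close>, so the linear term of the
    convexity inequality towards \<open>a\<close> disappears.\<close>
  have "\<Phi> x\<^sub>0 y\<^sub>0 \<le> \<Phi> a y\<^sub>0"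
    using convex[OF x\<^sub>0 a_in_C, of y\<^sub>0] D0 Gq0 by (simp add: dissipation_def inner_diff_right)
  moreover have "\<Phi> a y\<^sub>0 \<le> \<Phi> a b" using saddle by (auto simp: saddle_point_def)
  moreover have "\<Phi> a b \<le> \<Phi> x\<^sub>0 b" using saddle x\<^sub>0 by (auto simp: saddle_point_def)
  ultimately have val: "\<Phi> x\<^sub>0 y\<^sub>0 = \<Phi> a b" using max[of b] by linarith
  have min: "\<Phi> x\<^sub>0 y\<^sub>0 \<le> \<Phi> x y\<^sub>0" if x: "x \<in> C" for x
  proof (rule ccontr)
    assume "\<not> \<Phi> x\<^sub>0 y\<^sub>0 \<le> \<Phi> x y\<^sub>0"
    \<comment> \<open>One third of the gap is lost to the variation of \<open>\<Phi> x\<close> near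
      \<open>y\<^sub>0\<close>, one third to the approximate value of \<open>\<Phi>\<close> along
      the trajectory, and the last third remains as the rate of decrease of
      \<open>Vp x\<close>.\<close>
    define e where "e = (\<Phi> a b - \<Phi> x y\<^sub>0) / 3"
    have e: "e > 0" "\<Phi> x y\<^sub>0 = \<Phi> a b - 3 * e" using \<open>\<not> _\<close> val by (auto simp: e_def field_simps)
    have "continuous_on UNIV (\<lambda>y. \<Phi> (fst (x, y)) (snd (x, y)))"
      by (rule continuous_on_compose2[OF cont_\<Phi>]) (auto intro!: continuous_intros)
    then have "continuous_on UNIV (\<Phi> x)" by simp
    then obtain r where r: "r > 0" "\<And>y. dist y y\<^sub>0 < r \<Longrightarrow> dist (\<Phi> x y) (\<Phi> x y\<^sub>0) < e"
      unfolding continuous_on_iff using e(1) by (metis UNIV_I)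
    obtain B where B: "\<And>t. t \<ge> 0 \<Longrightarrow> norm (p t, q t) \<le> B" using bounded_trajectory by blast
    define W where "W = (B + norm x)\<^sup>2 / 2"
    have W: "0 \<le> Vp x t" "Vp x t \<le> W" if "t \<ge> 0" for t
    proof -
      show "0 \<le> Vp x t" by (simp add: Vp_def)
      have "norm (p t - x) \<le> B + norm x"
        using norm_triangle_ineq4[of "p t" x] norm_fst_le[of "p t" "q t"] B[OF that] by simp
      then have "(norm (p t - x))\<^sup>2 \<le> (B + norm x)\<^sup>2" by (intro power_mono) auto
      then show "Vp x t \<le> W" by (simp add: Vp_def W_def power2_norm_eq_inner)
    qed
    have "W \<ge> 0" by (simp add: W_def)
    \<comment> \<open>Over a window of this length the decrease is \<open>W + 1\<close>, more than
      the range \<open>0..W\<close> of \<open>Vp x\<close> allows.\<close>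
    define T where "T = (W + 1) / e"
    have T: "T > 0" "e * T = W + 1" using e \<open>W \<ge> 0\<close> by (auto simp: T_def intro: add_nonneg_pos)
    \<comment> \<open>At this speed \<open>q\<close> drifts at most \<open>r / 2\<close> during the
      window; starting within \<open>r / 2\<close> of \<open>y\<^sub>0\<close> it stays within
      \<open>r\<close>.\<close>
    have "eventually (\<lambda>t. norm (Gq (p t) (q t)) < r / (2 * T)) at_top"
      using tendstoD[OF Gq_tendsto_0, of "r / (2 * T)"] r T by simp
    from eventually_conj[OF this value_lower_bound[OF e(1)]]
    obtain t1 where t1: "\<And>t. t \<ge> t1 \<Longrightarrow> norm (Gq (p t) (q t)) < r / (2 * T)"
      "\<And>t. t \<ge> t1 \<Longrightarrow> \<Phi> a b - e < \<Phi> (p t) (q t)"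
      unfolding eventually_at_top_linorder by blast
    have "eventually (\<lambda>n. max t1 0 \<le> \<tau> n) sequentially" by (rule ev\<tau>[OF eventually_ge_at_top])
    moreover have "eventually (\<lambda>n. dist (q (\<tau> n)) y\<^sub>0 < r / 2) sequentially"
      using tendstoD[OF lim_q, of "r / 2"] r by simp
    ultimately have "eventually (\<lambda>n. max t1 0 \<le> \<tau> n \<and> dist (q (\<tau> n)) y\<^sub>0 < r / 2) sequentially"
      by (rule eventually_conj)
    then obtain n where n: "max t1 0 \<le> \<tau> n" "dist (q (\<tau> n)) y\<^sub>0 < r / 2"
      using eventually_happens' by (metis (no_types, lifting) sequentially_bot)
    define t0 where "t0 = \<tau> n"
    have t0: "0 \<le> t0" "t1 \<le> t0" "dist (q t0) y\<^sub>0 < r / 2" using n by (auto simp: t0_def)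
    have near: "\<Phi> x (q t) < \<Phi> a b - 2 * e" if t: "t0 \<le> t" "t \<le> t0 + T" for t
    proof -
      have q_ac: "abs_continuous_on {0..t} q"
        by (rule abs_continuous_on_lipschitz[OF ac order_refl, where M = 1])
          (use t t0 norm_snd_le[of "q _ - q _" "p _ - p _"] in auto)
      have "norm (q t - q t0) \<le> r / (2 * T) * (t - t0)"
      proof (rule AE_vector_derivative_lipschitz[OF t0(1) t(1) _ q_ac])
        show "AE s in lebesgue. t0 < s \<longrightarrow> s < t \<longrightarrow> (\<exists>d. (q has_vector_derivative d) (at s) \<and> norm d \<le> r / (2 * T))"
          using flow_variational
        proof eventually_elim
          case (elim s)
          show ?case
            using elim t1(1)[of s] t0 by (intro impI exI[of _ "Gq (p s) (q s)"]) auto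
        qed
      qed (use r T in auto)
      also have "\<dots> \<le> r / (2 * T) * T" using t r T by (intro mult_left_mono) auto
      also have "\<dots> = r / 2" using T by simp
      finally have "dist (q t) y\<^sub>0 < r"
        using t0(3) dist_triangle[of "q t" y\<^sub>0 "q t0"] by (simp add: dist_norm)
      then show ?thesis using r(2)[of "q t"] e(2) by (auto simp: dist_real_def abs_less_iff)
    qed
    have "Vp x (t0 + T) - Vp x t0 \<le> - e * (t0 + T - t0)"
    proof (rule AE_derivative_bound[OF t0(1) _ Vp_ac])
      show "AE t in lebesgue. t0 < t \<longrightarrow> t < t0 + T \<longrightarrow> (\<exists>d\<le>- e. (Vp x has_real_derivative d) (at t))"
        using Vp_derivative
      proof eventually_elim
        case (elim t)
        show ?case
        proof (intro impI)
          assume t: "t0 < t" "t < t0 + T"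
          then obtain d where d: "d \<le> - Gp (p t) (q t) \<bullet> (p t - x)" "(Vp x has_real_derivative d) (at t)"
            using elim x t0(1) by auto
          have "\<Phi> (p t) (q t) + Gp (p t) (q t) \<bullet> (x - p t) \<le> \<Phi> x (q t)"
            using t t0(1) by (intro convex p_in_C x) auto
          moreover have "\<Phi> a b - e < \<Phi> (p t) (q t)" using t t0 by (intro t1(2)) auto
          ultimately have "d \<le> - e" using d(1) near[of t] t by (simp add: inner_diff_right)
          then show "\<exists>d\<le>- e. (Vp x has_real_derivative d) (at t)" using d(2) by blast
        qed
      qed
    qed (use t0 T in auto)
    then have "Vp x (t0 + T) - Vp x t0 \<le> - (W + 1)" using T by simp
    then show False using W[of t0] W[of "t0 + T"] t0 T by simp
  qed
  show ?thesis unfolding saddle_point_def using x\<^sub>0 max min by auto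
qed

theorem converges_to_saddle_point:
  "\<exists>x\<^sub>0 y\<^sub>0. saddle_point \<Phi> C UNIV x\<^sub>0 y\<^sub>0 \<and> ((\<lambda>t. (p t, q t)) \<longlongrightarrow> (x\<^sub>0, y\<^sub>0)) at_top"
proof -
  obtain B where B: "\<And>t. t \<ge> 0 \<Longrightarrow> norm (p t, q t) \<le> B" using bounded_trajectory by blast
  have "\<forall>n. (p (real n), q (real n)) \<in> cball 0 B" by (simp add: B)
  from compact_cball[of "0 :: 'a \<times> 'b" B, unfolded compact_def, THEN spec, THEN mp, OF this]
  obtain z r where r: "strict_mono r" "((\<lambda>n. (p (real n), q (real n))) \<circ> r) \<longlonglongrightarrow> z" by blast
  obtain x\<^sub>0 y\<^sub>0 where z: "z = (x\<^sub>0, y\<^sub>0)" by fastforce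
  have \<tau>: "filterlim (\<lambda>n. real (r n)) at_top sequentially"
    by (rule filterlim_compose[OF filterlim_real_sequentially filterlim_subseq[OF r(1)]])
  have lim: "(\<lambda>n. (p (real (r n)), q (real (r n)))) \<longlonglongrightarrow> (x\<^sub>0, y\<^sub>0)" using r(2) z by (simp add: o_def)
  have s: "saddle_point \<Phi> C UNIV x\<^sub>0 y\<^sub>0" by (rule saddle_limit_point[OF \<tau> lim])
  define N where "N t = (norm ((p t, q t) - (x\<^sub>0, y\<^sub>0)))\<^sup>2" for t
  have NV: "N t = 2 * (Vp x\<^sub>0 t + Vq y\<^sub>0 t)" for t
    unfolding N_def power2_norm_eq_inner by (simp add: Vp_def Vq_def)
  have "((\<lambda>t. (p t, q t)) \<longlongrightarrow> (x\<^sub>0, y\<^sub>0)) at_top"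
  proof (rule tendstoI)
    fix e :: real assume e: "e > 0"
    have "(\<lambda>n. norm ((p (real (r n)), q (real (r n))) - (x\<^sub>0, y\<^sub>0))) \<longlonglongrightarrow> 0"
      using lim by (simp only: LIM_zero tendsto_norm_zero)
    from eventually_happens'[OF sequentially_bot order_tendstoD(2)[OF this e]]
    obtain n where n: "norm ((p (real (r n)), q (real (r n))) - (x\<^sub>0, y\<^sub>0)) < e" by blast
    show "eventually (\<lambda>t. dist (p t, q t) (x\<^sub>0, y\<^sub>0) < e) at_top"
      using eventually_ge_at_top[of "real (r n)"]
    proof eventually_elim
      case (elim t)
      have "N t \<le> N (real (r n))" using V_decreasing[OF s _ elim] by (simp add: NV)
      then have "norm ((p t, q t) - (x\<^sub>0, y\<^sub>0)) \<le> norm ((p (real (r n)), q (real (r n))) - (x\<^sub>0, y\<^sub>0))"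
        unfolding N_def by (rule power2_le_imp_le) (rule norm_ge_zero)
      then show ?case using n unfolding dist_norm by linarith
    qed
  qed
  with s show ?thesis by blast
qed

end

section \<open>Linear algebra and convexity\<close>

lemma symmetric_inner_matrix:
  fixes M :: "real^'a^'a"
  assumes "transpose M = M"
  shows "x \<bullet> (M *v y) = (M *v x) \<bullet> y"
  by (metis assms dot_lmul_matrix transpose_matrix_vector)

lemma symmetric_quadratic_add:
  fixes M :: "real^'a^'a"
  assumes "transpose M = M"
  shows "(x + y) \<bullet> (M *v (x + y)) = x \<bullet> (M *v x) + 2 * ((M *v x) \<bullet> y) + y \<bullet> (M *v y)"
  using symmetric_inner_matrix[OF assms, of x y]
  by (simp add: matrix_vector_right_distrib inner_add_left inner_add_right inner_commute)

text \<open>A zero of a nonnegative quadratic form is a minimizer, so the gradient of the form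
  vanishes there. Applied to the Laplacian forms it turns zero energy into consensus equations;
  applied to a shifted matrix it produces an eigenvector.\<close>

lemma psd_quadratic_zero:
  fixes M :: "real^'a^'a"
  assumes sym: "transpose M = M" and psd: "\<And>x. 0 \<le> x \<bullet> (M *v x)" and x: "x \<bullet> (M *v x) = 0"
  shows "M *v x = 0"
proof -
  define y where "y = M *v x"
  define c d where "c = y \<bullet> y" and "d = y \<bullet> (M *v y)"
  have d: "d \<ge> 0" unfolding d_def by (rule psd)
  \<comment> \<open>A multiple of a step from \<open>x\<close> against the gradient direction
    \<open>y = M *v x\<close>. As the \<open>x\<close> term vanishes, the form equals
    \<open>c\<^sup>2 * d - 2 * (d + 1) * c\<^sup>2\<close>.\<close>
  have "0 \<le> ((d + 1) *\<^sub>R x + (- c) *\<^sub>R y) \<bullet> (M *v ((d + 1) *\<^sub>R x + (- c) *\<^sub>R y))" by (rule psd)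
  also have "\<dots> = - (c\<^sup>2 * (d + 2))"
    unfolding symmetric_quadratic_add[OF sym]
    using x by (simp add: matrix_vector_mult_scaleR y_def[symmetric] c_def[symmetric] d_def[symmetric]
        power2_eq_square algebra_simps del: scaleR_minus_left)
  finally have "c\<^sup>2 * (d + 2) \<le> 0" by simp
  then have "c = 0" using d by (auto simp: mult_le_0_iff)
  then show ?thesis by (simp add: c_def y_def)
qed

lemma symmetric_component:
  assumes "transpose M = M"
  shows "M $ j $ i = M $ i $ j"
  using arg_cong[OF assms, of "\<lambda>M. M $ i $ j"] by (simp add: transpose_def)

lemma laplacian_symmetric:
  assumes "transpose A = (A :: real^'n^'n)"
  shows "transpose (laplacian A) = laplacian A"
proof -
  have "laplacian A $ j $ i = laplacian A $ i $ j" for i j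
    using symmetric_component[OF assms, of i j] by (simp add: laplacian_def degree_matrix_def)
  then show ?thesis by (simp add: transpose_def vec_eq_iff)
qed

text \<open>Averaging the double sum with its copy under exchange of indices gives half the sum of
  \<open>A $ i $ j * (x $ i - x $ j)\<^sup>2\<close>.\<close>

lemma laplacian_psd:
  fixes A :: "real^'n^'n"
  assumes sym: "transpose A = A" and nonneg: "\<And>i j. 0 \<le> A $ i $ j"
  shows "0 \<le> x \<bullet> (laplacian A *v x)"
proof -
  have row: "(laplacian A *v x) $ i = (\<Sum>j\<in>UNIV. A $ i $ j * (x $ i - x $ j))" for i
  proof -
    have "(laplacian A *v x) $ i = (\<Sum>j\<in>UNIV. (if i = j then (\<Sum>l\<in>UNIV. A $ i $ l) * x $ j else 0) - A $ i $ j * x $ j)"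
      unfolding laplacian_def degree_matrix_def matrix_vector_mult_def
      by (auto intro!: sum.cong simp: left_diff_distrib)
    also have "\<dots> = (\<Sum>l\<in>UNIV. A $ i $ l) * x $ i - (\<Sum>j\<in>UNIV. A $ i $ j * x $ j)"
      by (simp add: sum_subtractf)
    also have "\<dots> = (\<Sum>j\<in>UNIV. A $ i $ j * (x $ i - x $ j))"
      by (simp add: sum_subtractf sum_distrib_right right_diff_distrib)
    finally show ?thesis .
  qed
  define S where "S = (\<Sum>i\<in>UNIV. \<Sum>j\<in>UNIV. A $ i $ j * (x $ i - x $ j) * x $ i)"
  have eq: "x \<bullet> (laplacian A *v x) = S"
    unfolding inner_vec_def row S_def by (simp add: sum_distrib_left sum_distrib_right mult_ac)
  have S': "S = (\<Sum>i\<in>UNIV. \<Sum>j\<in>UNIV. A $ i $ j * (x $ j - x $ i) * x $ j)"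
    unfolding S_def by (subst sum.swap, intro sum.cong refl) (simp only: symmetric_component[OF sym])
  have "S + S = (\<Sum>i\<in>UNIV. \<Sum>j\<in>UNIV. A $ i $ j * (x $ i - x $ j) * x $ i + A $ i $ j * (x $ j - x $ i) * x $ j)"
    by (subst (2) S') (simp only: S_def sum.distrib)
  also have "\<dots> = (\<Sum>i\<in>UNIV. \<Sum>j\<in>UNIV. A $ i $ j * (x $ i - x $ j)\<^sup>2)"
    by (intro sum.cong refl) (simp add: power2_eq_square algebra_simps)
  finally have "S + S = (\<Sum>i\<in>UNIV. \<Sum>j\<in>UNIV. A $ i $ j * (x $ i - x $ j)\<^sup>2)" .
  then have "S + S \<ge> 0" by (simp add: sum_nonneg nonneg)
  then show ?thesis by (simp add: eq)
qed

lemma kron_mat_1_symmetric: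
  assumes "transpose L = (L :: real^'n^'n)"
  shows "transpose (kron L (mat 1 :: real^'d^'d)) = kron L (mat 1 :: real^'d^'d)"
proof -
  have "kron L (mat 1 :: real^'d^'d) $ j $ i = kron L (mat 1 :: real^'d^'d) $ i $ j" for i j
    using symmetric_component[OF assms, of "fst i" "fst j"] by (simp add: kron_def mat_def eq_commute)
  then show ?thesis by (simp add: transpose_def vec_eq_iff)
qed

text \<open>With the identity as second factor the product acts separately on each of the
  \<open>'d\<close> coordinate slices, so nonnegativity is inherited from \<open>L\<close>.\<close>

lemma kron_mat_1_quadratic:
  fixes L :: "real^'n^'n" and x :: "real^('n::finite \<times> 'd::finite)"
  shows "x \<bullet> (kron L (mat 1 :: real^'d^'d) *v x) = (\<Sum>j\<in>UNIV. (\<chi> i. x $ (i, j)) \<bullet> (L *v (\<chi> i. x $ (i, j))))"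
proof -
  have row: "(kron L (mat 1 :: real^'d^'d) *v x) $ (i, j) = (\<Sum>i'\<in>UNIV. L $ i $ i' * x $ (i', j))" for i j
  proof -
    have "(kron L (mat 1 :: real^'d^'d) *v x) $ (i, j) =
        (\<Sum>(i', j')\<in>UNIV \<times> UNIV. L $ i $ i' * (if j = j' then 1 else 0) * x $ (i', j'))"
      unfolding UNIV_Times_UNIV matrix_vector_mult_def kron_def mat_def by (auto intro!: sum.cong)
    also have "\<dots> = (\<Sum>i'\<in>UNIV. \<Sum>j'\<in>UNIV. (if j = j' then L $ i $ i' * x $ (i', j') else 0))"
      unfolding sum.cartesian_product[symmetric] by (intro sum.cong refl) simp
    finally show ?thesis by simp
  qed
  have "x \<bullet> (kron L (mat 1 :: real^'d^'d) *v x) =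
      (\<Sum>(i, j)\<in>UNIV \<times> UNIV. x $ (i, j) * (\<Sum>i'\<in>UNIV. L $ i $ i' * x $ (i', j)))"
    unfolding UNIV_Times_UNIV inner_vec_def by (auto intro!: sum.cong simp: row)
  also have "\<dots> = (\<Sum>j\<in>UNIV. \<Sum>i\<in>UNIV. x $ (i, j) * (\<Sum>i'\<in>UNIV. L $ i $ i' * x $ (i', j)))"
    unfolding sum.cartesian_product[symmetric] by (rule sum.swap)
  finally show ?thesis by (simp add: inner_vec_def matrix_vector_mult_def)
qed

text \<open>\<open>lambda_max\<close> is defined by \<open>GREATEST\<close>, so a greatest
  eigenvalue must be exhibited. It is the maximum of the quadratic form on the unit sphere, attained
  by compactness; the same maximum gives the Rayleigh bound.\<close>

lemma symmetric_lambda_max: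
  fixes M :: "real^'m^'m"
  assumes sym: "transpose M = M"
  shows eigenvalue_lambda_max: "eigenvalue M (lambda_max M)"
    and rayleigh_le_lambda_max: "x \<bullet> (M *v x) \<le> lambda_max M * (x \<bullet> x)"
proof -
  define r where "r x = x \<bullet> (M *v x)" for x
  have "continuous_on (sphere 0 1) r"
    unfolding r_def by (intro continuous_intros linear_continuous_on_compose[of _ id, simplified] matrix_vector_mul_linear)
  moreover have "sphere (0 :: real^'m) 1 \<noteq> {}" by simp
  ultimately obtain u where u: "u \<in> sphere 0 1" "\<And>x. x \<in> sphere 0 1 \<Longrightarrow> r x \<le> r u"
    using continuous_attains_sup[OF compact_sphere] by metis
  have uu: "u \<bullet> u = 1" using u(1) by (simp add: norm_eq_1)
  have le: "r x \<le> r u * (x \<bullet> x)" for x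
  proof (cases "x = 0")
    case False
    define y where "y = x /\<^sub>R norm x"
    have "y \<in> sphere 0 1" using False by (simp add: y_def)
    moreover have "x = norm x *\<^sub>R y" using False by (simp add: y_def)
    then have "r x = (norm x)\<^sup>2 * r y"
      unfolding r_def by (metis inner_scaleR_left inner_scaleR_right matrix_vector_mult_scaleR mult.assoc power2_eq_square)
    ultimately show ?thesis using u(2)[of y]
      by (simp add: power2_norm_eq_inner mult.commute[of "x \<bullet> x"] mult_right_mono)
  qed (simp add: r_def)
  \<comment> \<open>Positive semidefinite by maximality of \<open>r u\<close>, with a form vanishing
    at \<open>u\<close>; hence \<open>N *v u = 0\<close>, which is the eigenvector equation.\<close>
  define N where "N = r u *\<^sub>R mat 1 - M"
  have Nv: "N *v x = r u *\<^sub>R x - M *v x" for x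
    by (simp add: N_def matrix_vector_mult_diff_rdistrib scaleR_matrix_vector_assoc[symmetric])
  have "transpose N = N"
    using sym by (auto simp: N_def transpose_def vec_eq_iff mat_def)
  moreover have "0 \<le> x \<bullet> (N *v x)" for x using le[of x] by (simp add: Nv inner_diff_right r_def)
  moreover have "u \<bullet> (N *v u) = 0" using uu by (simp add: Nv inner_diff_right r_def)
  ultimately have "N *v u = 0" by (rule psd_quadratic_zero)
  then have ev: "eigenvalue M (r u)" unfolding eigenvalue_def using uu by (auto simp: Nv intro!: exI[of _ u])
  have "c \<le> r u" if c: "eigenvalue M c" for c
  proof -
    obtain w where w: "w \<noteq> 0" "M *v w = c *\<^sub>R w" using c by (auto simp: eigenvalue_def)
    then have "c * (w \<bullet> w) \<le> r u * (w \<bullet> w)" using le[of w] by (simp add: r_def)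
    then show ?thesis using w by simp
  qed
  with ev have eq: "lambda_max M = r u" unfolding lambda_max_def by (intro Greatest_equality)
  show "eigenvalue M (lambda_max M)" using ev eq by simp
  show "x \<bullet> (M *v x) \<le> lambda_max M * (x \<bullet> x)" using le[of x] eq by (simp add: r_def)
qed

lemma grad_eqI:
  assumes "GDERIV \<phi> x :> D"
  shows "grad \<phi> x = D"
proof -
  have "D' = D" if "GDERIV \<phi> x :> D'" for D'
  proof -
    have "(\<lambda>h. h \<bullet> D') = (\<lambda>h. h \<bullet> D)"
      using has_derivative_unique assms that unfolding gderiv_def by blast
    then have "(D' - D) \<bullet> D' = (D' - D) \<bullet> D" by (rule fun_cong)
    then have "(D' - D) \<bullet> (D' - D) = 0" by (simp add: inner_diff_right)
    then show ?thesis by simp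
  qed
  then show ?thesis unfolding grad_def using assms by (intro the_equality)
qed

text \<open>The one-dimensional tangent inequality applied to \<open>l\<close> restricted to the
  line through \<open>x\<close> and \<open>y\<close>.\<close>

lemma convex_on_above_tangent_plane:
  assumes l: "convex_on UNIV l" and D: "GDERIV l x :> D"
  shows "l x + D \<bullet> (y - x) \<le> l y"
proof -
  define \<phi> where "\<phi> t = l (x + t *\<^sub>R (y - x))" for t :: real
  have "convex_on UNIV \<phi>"
  proof (rule convex_onI)
    fix t u w :: real assume t: "0 < t" "t < 1"
    have "x + ((1 - t) *\<^sub>R u + t *\<^sub>R w) *\<^sub>R (y - x) = (1 - t) *\<^sub>R (x + u *\<^sub>R (y - x)) + t *\<^sub>R (x + w *\<^sub>R (y - x))"
      by (simp add: algebra_simps)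
    then show "\<phi> ((1 - t) *\<^sub>R u + t *\<^sub>R w) \<le> (1 - t) * \<phi> u + t * \<phi> w"
      unfolding \<phi>_def using convex_onD[OF l, of t] t by simp
  qed simp
  moreover have "(\<phi> has_real_derivative D \<bullet> (y - x)) (at 0)"
  proof -
    have "(l has_derivative (\<lambda>h. h \<bullet> D)) (at (x + 0 *\<^sub>R (y - x)))" using D by (simp add: gderiv_def)
    moreover have "((\<lambda>t. x + t *\<^sub>R (y - x)) has_derivative (\<lambda>t. t *\<^sub>R (y - x))) (at 0)"
      by (auto intro!: derivative_eq_intros)
    ultimately have "(\<phi> has_derivative (\<lambda>t. (t *\<^sub>R (y - x)) \<bullet> D)) (at 0)"
      unfolding \<phi>_def by (rule has_derivative_compose[rotated])
    then show ?thesis unfolding has_field_derivative_def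
      by (rule has_derivative_eq_rhs) (auto simp: inner_commute)
  qed
  ultimately have "\<phi> 1 - \<phi> 0 \<ge> D \<bullet> (y - x) * (1 - 0)"
    by (intro convex_on_imp_above_tangent[where A = UNIV]) auto
  then show ?thesis by (simp add: \<phi>_def)
qed

section \<open>The augmented Lagrangian of a quadratic loss\<close>

lemma GDERIV_from_increment:
  assumes "\<And>y. \<phi> y = c + (y - x) \<bullet> D + r y" and "(r has_derivative (\<lambda>_. 0)) (at x)"
  shows "GDERIV \<phi> x :> D"
proof -
  have "((\<lambda>y. c + (y - x) \<bullet> D + r y) has_derivative (\<lambda>h. h \<bullet> D)) (at x)"
    using assms(2) by (auto intro!: derivative_eq_intros)
  then show ?thesis unfolding gderiv_def using assms(1) by presburger
qed

lemma has_derivative_quadratic_0: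
  fixes M :: "real^'a^'a"
  shows "((\<lambda>y. c * ((y - x) \<bullet> (M *v (y - x)))) has_derivative (\<lambda>_. 0)) (at x)"
proof -
  have "((\<lambda>y. M *v (y - x)) has_derivative (\<lambda>h. M *v (h - 0))) (at x)"
    by (rule bounded_linear.has_derivative[OF matrix_vector_mul_bounded_linear]) (auto intro!: derivative_eq_intros)
  then show ?thesis by (auto intro!: derivative_eq_intros)
qed

lemma continuous_on_matrix_vector_mult [continuous_intros]:
  fixes M :: "real^'a^'b"
  shows "continuous_on S f \<Longrightarrow> continuous_on S (\<lambda>z. M *v f z)"
  by (rule bounded_linear.continuous_on[OF matrix_vector_mul_bounded_linear])

lemma bounded_linear_block: "bounded_linear (\<lambda>x. block x i)"
  unfolding linear_conv_bounded_linear[symmetric] by (rule linearI) (simp_all add: block_def vec_eq_iff)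

lemmas continuous_on_block [continuous_intros] = bounded_linear.continuous_on[OF bounded_linear_block]

lemma block_add: "block (x + y) i = block x i + block y i"
  by (simp add: block_def vec_eq_iff)

text \<open>The adjoint of \<open>block\<close>, as \<open>inner_unblock\<close> confirms; it
  carries the gradient contribution of one agent into the stacked space.\<close>

definition unblock :: "'n::finite \<Rightarrow> real^'d::finite \<Rightarrow> real^('n \<times> 'd)" where
  "unblock i c = (\<chi> j. if fst j = i then c $ snd j else 0)"

lemma inner_unblock: "unblock i c \<bullet> x = c \<bullet> block x i"
proof -
  have "unblock i c \<bullet> x = (\<Sum>(i', j)\<in>UNIV \<times> UNIV. (if i' = i then c $ j else 0) * x $ (i', j))"
    unfolding UNIV_Times_UNIV inner_vec_def unblock_def by (auto intro!: sum.cong)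
  also have "\<dots> = (\<Sum>i'\<in>UNIV. if i' = i then \<Sum>j\<in>UNIV. c $ j * x $ (i', j) else 0)"
    unfolding sum.cartesian_product[symmetric] by (intro sum.cong refl) simp
  also have "\<dots> = c \<bullet> block x i" by (simp add: inner_vec_def block_def)
  finally show ?thesis .
qed

lemma bounded_linear_unblock: "bounded_linear (unblock i)"
  unfolding linear_conv_bounded_linear[symmetric] by (rule linearI) (simp_all add: unblock_def vec_eq_iff)

lemmas continuous_on_unblock [continuous_intros] = bounded_linear.continuous_on[OF bounded_linear_unblock]

lemma bounded_linear_axis: "bounded_linear (axis i :: 'a::euclidean_space \<Rightarrow> 'a^'n)"
  unfolding linear_conv_bounded_linear[symmetric] by (rule linearI) (simp_all add: axis_def vec_eq_iff)

lemmas continuous_on_axis' [continuous_intros] = bounded_linear.continuous_on[OF bounded_linear_axis]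

locale quadratic_dro =
  fixes \<epsilon> :: real and s :: "'k::finite \<Rightarrow> real^'m::finite" and v :: "'k \<Rightarrow> 'n::finite"
    and f :: "real^'d::finite \<Rightarrow> real^'m \<Rightarrow> real" and Q :: "real^'m^'m" and R :: "real^'m^'d"
    and l :: "real^'d \<Rightarrow> real" and g :: "real^'d \<Rightarrow> real^'d" and L :: "real^'n^'n"
  assumes f_eq: "\<And>x \<xi>. f x \<xi> = \<xi> \<bullet> (Q *v \<xi>) + x \<bullet> (R *v \<xi>) + l x"
    and Q_sym: "transpose Q = Q"
    and L_sym: "transpose L = L" and L_psd: "\<And>x. 0 \<le> x \<bullet> (L *v x)"
    and g: "\<And>x. GDERIV l x :> g x" and g_cont: "continuous_on UNIV g"
    and l_convex: "convex_on UNIV l"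
begin

abbreviation "M \<equiv> kron L (mat 1 :: real^'d^'d)"
abbreviation "\<Phi> \<equiv> L_aug f \<epsilon> s v L"

lemma M_sym: "transpose M = M" by (rule kron_mat_1_symmetric[OF L_sym])

lemma M_psd: "0 \<le> x \<bullet> (M *v x)"
  unfolding kron_mat_1_quadratic by (intro sum_nonneg L_psd)

definition "grad_x x \<eta> \<xi> = (1 / real CARD('k)) *\<^sub>R (\<Sum>k\<in>UNIV. unblock (v k) (R *v \<xi> $ k + g (block x (v k)))) + M *v \<eta> + M *v x"

definition "grad_lam lam \<nu> \<xi> = (\<epsilon>\<^sup>2 / real CARD('n)) *\<^sub>R 1
   - (1 / real CARD('k)) *\<^sub>R (\<Sum>k\<in>UNIV. axis (v k) ((norm (\<xi> $ k - s k))\<^sup>2)) + L *v \<nu> + L *v lam"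

definition "grad_xi x lam \<xi> = (\<chi> k. (1 / real CARD('k)) *\<^sub>R (2 *\<^sub>R (Q *v \<xi> $ k) + transpose R *v block x (v k)
   - (2 * lam $ v k) *\<^sub>R (\<xi> $ k - s k)))"

text \<open>The increments below are exact; \<open>rem_l\<close> and \<open>slack\<close> are the nonnegative second-order remainders.
  Both the gradients and the convexity inequalities are read off from them.\<close>

definition "rem_l x \<delta> = (\<Sum>k\<in>UNIV. l (block (x + \<delta>) (v k)) - l (block x (v k)) - g (block x (v k)) \<bullet> block \<delta> (v k))"

lemma rem_l_nonneg: "0 \<le> rem_l x \<delta>"
  unfolding rem_l_def
proof (rule sum_nonneg)
  fix k
  show "0 \<le> l (block (x + \<delta>) (v k)) - l (block x (v k)) - g (block x (v k)) \<bullet> block \<delta> (v k)"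
    using convex_on_above_tangent_plane[OF l_convex g, of "block x (v k)" "block (x + \<delta>) (v k)"]
    by (simp add: block_add)
qed

text \<open>No mixed term in \<delta> and \<mu> arises, because for fixed \<xi> the variable
  \<open>x\<close> enters through \<open>f\<close> and \<open>lam\<close> linearly through the
  penalty, without a product of the two.\<close>

lemma primal_increment:
  "\<Phi> (x + \<delta>) (lam + \<mu>) \<nu> \<eta> \<xi> = \<Phi> x lam \<nu> \<eta> \<xi> + \<delta> \<bullet> grad_x x \<eta> \<xi> + \<mu> \<bullet> grad_lam lam \<nu> \<xi>
     + (1 / real CARD('k)) * rem_l x \<delta> + 1/2 * (\<delta> \<bullet> (M *v \<delta>)) + 1/2 * (\<mu> \<bullet> (L *v \<mu>))"
proof -
  have gk: "g_k f s k (block (x + \<delta>) (v k)) ((lam + \<mu>) $ v k) (\<xi> $ k) = g_k f s k (block x (v k)) (lam $ v k) (\<xi> $ k)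
     + block \<delta> (v k) \<bullet> (R *v \<xi> $ k + g (block x (v k))) - \<mu> $ v k * (norm (\<xi> $ k - s k))\<^sup>2
     + (l (block (x + \<delta>) (v k)) - l (block x (v k)) - g (block x (v k)) \<bullet> block \<delta> (v k))" for k
    by (simp add: g_k_def f_eq block_add inner_add_left inner_add_right inner_commute[of "g _"] algebra_simps)
  have sum_gk: "(\<Sum>k\<in>UNIV. g_k f s k (block (x + \<delta>) (v k)) ((lam + \<mu>) $ v k) (\<xi> $ k)) =
      (\<Sum>k\<in>UNIV. g_k f s k (block x (v k)) (lam $ v k) (\<xi> $ k))
      + (\<Sum>k\<in>UNIV. block \<delta> (v k) \<bullet> (R *v \<xi> $ k + g (block x (v k))))
      - (\<Sum>k\<in>UNIV. \<mu> $ v k * (norm (\<xi> $ k - s k))\<^sup>2) + rem_l x \<delta>"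
    unfolding gk rem_l_def by (simp add: sum.distrib sum_subtractf)
  have gx: "\<delta> \<bullet> grad_x x \<eta> \<xi> = 1 / real CARD('k) * (\<Sum>k\<in>UNIV. block \<delta> (v k) \<bullet> (R *v \<xi> $ k + g (block x (v k))))
      + \<delta> \<bullet> (M *v \<eta>) + \<delta> \<bullet> (M *v x)"
    unfolding grad_x_def inner_add_right inner_scaleR_right inner_sum_right
    by (simp only: inner_commute[of \<delta> "unblock _ _"] inner_unblock inner_commute[of _ "block \<delta> _"] inner_add_right)
  have gl: "\<mu> \<bullet> grad_lam lam \<nu> \<xi> = \<epsilon>\<^sup>2 / real CARD('n) * (\<mu> \<bullet> 1)
      - 1 / real CARD('k) * (\<Sum>k\<in>UNIV. \<mu> $ v k * (norm (\<xi> $ k - s k))\<^sup>2) + \<mu> \<bullet> (L *v \<nu>) + \<mu> \<bullet> (L *v lam)"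
    unfolding grad_lam_def by (simp add: inner_add_right inner_diff_right inner_sum_right inner_axis)
  have "\<nu> \<bullet> (L *v \<mu>) = \<mu> \<bullet> (L *v \<nu>)" "\<eta> \<bullet> (M *v \<delta>) = \<delta> \<bullet> (M *v \<eta>)"
    using symmetric_inner_matrix[OF L_sym] symmetric_inner_matrix[OF M_sym] by (simp_all add: inner_commute)
  then show ?thesis
    unfolding L_aug_def h_reg_def sum_gk gx gl symmetric_quadratic_add[OF M_sym] symmetric_quadratic_add[OF L_sym]
    by (simp add: matrix_vector_right_distrib inner_add_right inner_commute[of 1] inner_commute[of "M *v x"]
        inner_commute[of "L *v lam"] add_divide_distrib diff_divide_distrib ring_distribs)
qed

definition "slack lam \<zeta> = (1 / real CARD('k)) * (\<Sum>k\<in>UNIV. lam $ v k * (\<zeta> $ k \<bullet> \<zeta> $ k) - \<zeta> $ k \<bullet> (Q *v \<zeta> $ k))"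

text \<open>The Lagrangian is affine in \<nu> and \<eta> and quadratic in \<xi>, so the only
  second-order term is the one in \<zeta>, whose size depends on \<open>lam\<close> but not on
  \<open>x\<close>.\<close>

lemma dual_increment:
  "\<Phi> x lam (\<nu> + \<alpha>) (\<eta> + \<beta>) (\<xi> + \<zeta>) = \<Phi> x lam \<nu> \<eta> \<xi> + \<alpha> \<bullet> (L *v lam) + \<beta> \<bullet> (M *v x)
     + \<zeta> \<bullet> grad_xi x lam \<xi> - slack lam \<zeta>"
proof -
  have nrm: "(norm (\<xi> $ k + \<zeta> $ k - s k))\<^sup>2 = (norm (\<xi> $ k - s k))\<^sup>2 + 2 * (\<zeta> $ k \<bullet> (\<xi> $ k - s k)) + \<zeta> $ k \<bullet> \<zeta> $ k" for k
    by (simp add: power2_norm_eq_inner inner_add_left inner_add_right inner_diff_left inner_diff_right inner_commute)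
  have tr: "block x (v k) \<bullet> (R *v \<zeta> $ k) = \<zeta> $ k \<bullet> (transpose R *v block x (v k))" for k
    by (simp add: dot_lmul_matrix[symmetric] inner_commute)
  have gk: "g_k f s k (block x (v k)) (lam $ v k) ((\<xi> + \<zeta>) $ k) = g_k f s k (block x (v k)) (lam $ v k) (\<xi> $ k)
      + \<zeta> $ k \<bullet> (2 *\<^sub>R (Q *v \<xi> $ k) + transpose R *v block x (v k) - (2 * lam $ v k) *\<^sub>R (\<xi> $ k - s k))
      - (lam $ v k * (\<zeta> $ k \<bullet> \<zeta> $ k) - \<zeta> $ k \<bullet> (Q *v \<zeta> $ k))" for k
    unfolding g_k_def f_eq vector_add_component nrm symmetric_quadratic_add[OF Q_sym]
    unfolding matrix_vector_right_distrib inner_add_right inner_diff_right tr inner_scaleR_right inner_commute[of "Q *v \<xi> $ k"]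
    by (simp add: algebra_simps)
  have "\<zeta> \<bullet> grad_xi x lam \<xi> = 1 / real CARD('k) * (\<Sum>k\<in>UNIV. \<zeta> $ k \<bullet> (2 *\<^sub>R (Q *v \<xi> $ k) + transpose R *v block x (v k)
      - (2 * lam $ v k) *\<^sub>R (\<xi> $ k - s k)))"
    unfolding inner_vec_def[of \<zeta>] grad_xi_def vec_lambda_beta inner_scaleR_right sum_distrib_left ..
  then show ?thesis
    unfolding L_aug_def gk slack_def by (simp add: sum.distrib sum_subtractf inner_add_left ring_distribs)
qed

text \<open>The Rayleigh bound: a penalty weight of at least \<open>lambda_max Q\<close> dominates
  the convex term \<open>\<xi> \<bullet> (Q *v \<xi>)\<close>. This is how the constraint in
  \<open>C\<close> yields concavity in \<xi>.\<close>

lemma slack_nonneg: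
  assumes "\<And>i. lambda_max Q \<le> lam $ i"
  shows "0 \<le> slack lam \<zeta>"
  unfolding slack_def
proof (intro mult_nonneg_nonneg sum_nonneg)
  fix k
  have "lambda_max Q * (\<zeta> $ k \<bullet> \<zeta> $ k) \<le> lam $ v k * (\<zeta> $ k \<bullet> \<zeta> $ k)" using assms by (intro mult_right_mono) auto
  then show "0 \<le> lam $ v k * (\<zeta> $ k \<bullet> \<zeta> $ k) - \<zeta> $ k \<bullet> (Q *v \<zeta> $ k)"
    using rayleigh_le_lambda_max[OF Q_sym, of "\<zeta> $ k"] by linarith
qed simp

text \<open>Each summand is at least \<open>(lam $ v k - lambda_max Q) * (\<zeta> $ k \<bullet>
  \<zeta> $ k)\<close>, so strict inequality makes the second-order form definite.\<close>

lemma slack_eq_0: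
  assumes lam: "\<And>i. lambda_max Q < lam $ i" and "slack lam \<zeta> = 0"
  shows "\<zeta> = 0"
proof -
  have nonneg: "0 \<le> lam $ v k * (\<zeta> $ k \<bullet> \<zeta> $ k) - \<zeta> $ k \<bullet> (Q *v \<zeta> $ k)
    - (lam $ v k - lambda_max Q) * (\<zeta> $ k \<bullet> \<zeta> $ k)" for k
    using rayleigh_le_lambda_max[OF Q_sym, of "\<zeta> $ k"] by (simp add: algebra_simps)
  have pos: "0 \<le> (lam $ v k - lambda_max Q) * (\<zeta> $ k \<bullet> \<zeta> $ k)" for k
    using lam[of "v k"] by simp
  have "(\<Sum>k\<in>UNIV. lam $ v k * (\<zeta> $ k \<bullet> \<zeta> $ k) - \<zeta> $ k \<bullet> (Q *v \<zeta> $ k)) = 0"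
    using assms(2) by (simp add: slack_def)
  then have "lam $ v k * (\<zeta> $ k \<bullet> \<zeta> $ k) - \<zeta> $ k \<bullet> (Q *v \<zeta> $ k) = 0" for k
    using nonneg pos by (subst (asm) sum_nonneg_eq_0_iff) (auto intro: order_trans[OF pos], smt (verit))
  then have "(lam $ v k - lambda_max Q) * (\<zeta> $ k \<bullet> \<zeta> $ k) = 0" for k
    using nonneg[of k] pos[of k] by simp
  then have "\<zeta> $ k = 0" for k using lam[of "v k"] by (metis inner_eq_zero_iff less_irrefl mult_eq_0_iff right_minus_eq)
  then show ?thesis by (simp add: vec_eq_iff)
qed

lemma grad_L_aug_x: "grad (\<lambda>y. \<Phi> y lam \<nu> \<eta> \<xi>) x = grad_x x \<eta> \<xi>"
proof (rule grad_eqI, rule GDERIV_from_increment)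
  fix y
  show "\<Phi> y lam \<nu> \<eta> \<xi> = \<Phi> x lam \<nu> \<eta> \<xi> + (y - x) \<bullet> grad_x x \<eta> \<xi> + (1 / real CARD('k) * rem_l x (y - x) + 1/2 * ((y - x) \<bullet> (M *v (y - x))))"
    using primal_increment[of x "y - x" lam 0] by simp
next
  have lk: "((\<lambda>y. l (block y (v k))) has_derivative (\<lambda>h. block h (v k) \<bullet> g (block x (v k)))) (at x)" for k
    using has_derivative_compose[OF bounded_linear.has_derivative[OF bounded_linear_block has_derivative_ident] g[unfolded gderiv_def]] .
  have lk': "((\<lambda>y. l (block y (v k)) - c) has_derivative (\<lambda>h. block h (v k) \<bullet> g (block x (v k)))) (at x)" for k c
    using has_derivative_diff[OF lk has_derivative_const] by simp
  have bk: "((\<lambda>y. block (y - x) (v k)) has_derivative (\<lambda>h. block h (v k))) (at x)" for k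
    by (rule bounded_linear.has_derivative[OF bounded_linear_block]) (auto intro!: derivative_eq_intros)
  have "((\<lambda>y. rem_l x (y - x)) has_derivative (\<lambda>h. \<Sum>k\<in>(UNIV :: 'k set).
      block h (v k) \<bullet> g (block x (v k)) - g (block x (v k)) \<bullet> block h (v k))) (at x)"
    unfolding rem_l_def by (auto intro!: derivative_intros lk' bk has_derivative_inner_right)
  then have "((\<lambda>y. rem_l x (y - x)) has_derivative (\<lambda>_. 0)) (at x)" by (simp add: inner_commute)
  then show "((\<lambda>y. 1 / real CARD('k) * rem_l x (y - x) + 1/2 * ((y - x) \<bullet> (M *v (y - x)))) has_derivative (\<lambda>_. 0)) (at x)"
    by (intro has_derivative_eq_rhs[OF has_derivative_add[OF has_derivative_mult_right has_derivative_quadratic_0]]) auto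
qed

lemma grad_L_aug_lam: "grad (\<lambda>y. \<Phi> x y \<nu> \<eta> \<xi>) lam = grad_lam lam \<nu> \<xi>"
proof (rule grad_eqI, rule GDERIV_from_increment)
  fix y
  show "\<Phi> x y \<nu> \<eta> \<xi> = \<Phi> x lam \<nu> \<eta> \<xi> + (y - lam) \<bullet> grad_lam lam \<nu> \<xi> + 1/2 * ((y - lam) \<bullet> (L *v (y - lam)))"
    using primal_increment[of x 0 lam "y - lam"] by (simp add: rem_l_def block_def zero_vec_def[symmetric])
qed (rule has_derivative_quadratic_0)

lemma grad_L_aug_nu: "grad (\<lambda>y. \<Phi> x lam y \<eta> \<xi>) \<nu> = L *v lam"
proof (rule grad_eqI, rule GDERIV_from_increment)
  fix y
  show "\<Phi> x lam y \<eta> \<xi> = \<Phi> x lam \<nu> \<eta> \<xi> + (y - \<nu>) \<bullet> (L *v lam) + 0"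
    using dual_increment[of x lam \<nu> "y - \<nu>" \<eta> 0 \<xi> 0] by (simp add: slack_def)
qed simp

lemma grad_L_aug_eta: "grad (\<lambda>y. \<Phi> x lam \<nu> y \<xi>) \<eta> = M *v x"
proof (rule grad_eqI, rule GDERIV_from_increment)
  fix y
  show "\<Phi> x lam \<nu> y \<xi> = \<Phi> x lam \<nu> \<eta> \<xi> + (y - \<eta>) \<bullet> (M *v x) + 0"
    using dual_increment[of x lam \<nu> 0 \<eta> "y - \<eta>" \<xi> 0] by (simp add: slack_def)
qed simp

lemma grad_L_aug_xi:
  "grad (\<lambda>y. \<Phi> x lam \<nu> \<eta> (\<chi> j. if j = k then y else \<xi> $ j)) (\<xi> $ k) = grad_xi x lam \<xi> $ k"
proof (rule grad_eqI, rule GDERIV_from_increment)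
  fix y
  have upd: "(\<chi> j. if j = k then y else \<xi> $ j) = \<xi> + axis k (y - \<xi> $ k)"
    by (auto simp: vec_eq_iff axis_def)
  have "slack lam (axis k z) = 1 / real CARD('k) * (lam $ v k * (z \<bullet> z) - z \<bullet> (Q *v z))" for z :: "real^'m"
    unfolding slack_def
    by (subst sum.remove[of _ k]) (auto simp: axis_def intro!: sum.neutral)
  \<comment> \<open>The remainder is split into two quadratic forms, with \<open>mat 1\<close>
    standing for the squared norm, so that \<open>has_derivative_quadratic_0\<close> covers
    both.\<close>
  then show "\<Phi> x lam \<nu> \<eta> (\<chi> j. if j = k then y else \<xi> $ j) = \<Phi> x lam \<nu> \<eta> \<xi> + (y - \<xi> $ k) \<bullet> (grad_xi x lam \<xi> $ k)
      + (- (lam $ v k / real CARD('k)) * ((y - \<xi> $ k) \<bullet> (mat 1 *v (y - \<xi> $ k))) + 1 / real CARD('k) * ((y - \<xi> $ k) \<bullet> (Q *v (y - \<xi> $ k))))"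
    using dual_increment[of x lam \<nu> 0 \<eta> 0 \<xi> "axis k (y - \<xi> $ k)"] unfolding upd
    by (simp add: inner_axis' diff_divide_distrib)
next
  show "((\<lambda>y. - (lam $ v k / real CARD('k)) * ((y - \<xi> $ k) \<bullet> (mat 1 *v (y - \<xi> $ k))) + 1 / real CARD('k) * ((y - \<xi> $ k) \<bullet> (Q *v (y - \<xi> $ k))))
      has_derivative (\<lambda>_. 0)) (at (\<xi> $ k))"
    by (rule has_derivative_eq_rhs[OF has_derivative_add[OF has_derivative_quadratic_0 has_derivative_quadratic_0]]) simp
qed

end

lemma has_vector_derivative_vec:
  fixes \<xi> :: "real \<Rightarrow> ('a::euclidean_space)^'k"
  assumes "\<And>k. ((\<lambda>r. \<xi> r $ k) has_vector_derivative D $ k) (at t)"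
  shows "(\<xi> has_vector_derivative D) (at t)"
  unfolding has_vector_derivative_def has_derivative_componentwise_within[of \<xi>]
proof
  fix e :: "'a^'k" assume "e \<in> Basis"
  then obtain k u where e: "e = axis k u" by (auto simp: Basis_vec_def)
  have "((\<lambda>r. \<xi> r $ k \<bullet> u) has_derivative (\<lambda>h. h *\<^sub>R D $ k \<bullet> u)) (at t)"
    using bounded_linear.has_derivative[OF bounded_linear_inner_left assms[of k, unfolded has_vector_derivative_def]] .
  then show "((\<lambda>r. \<xi> r \<bullet> e) has_derivative (\<lambda>h. h *\<^sub>R D \<bullet> e)) (at t)" by (simp add: e inner_axis)
qed

lemma SUP_quadratic_PInfty:
  fixes a b c :: real
  assumes "a > 0" and \<phi>: "\<And>r. \<phi> (r *\<^sub>R u) = a * r\<^sup>2 + b * r + c"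
  shows "(SUP y. ereal (\<phi> y)) = \<infinity>"
proof (rule SUP_PInfty)
  fix n :: nat
  \<comment> \<open>Chosen so that \<open>r \<ge> 1\<close> and
    \<open>a * r + b \<ge> \<bar>c\<bar> + real n\<close>; then
    \<open>r * (a * r + b) + c \<ge> real n\<close>.\<close>
  define r where "r = 1 + (\<bar>b\<bar> + \<bar>c\<bar> + real n) / a"
  have ar: "a * r = a + \<bar>b\<bar> + \<bar>c\<bar> + real n" using \<open>a > 0\<close> by (simp add: r_def field_simps)
  have "r \<ge> 1" using \<open>a > 0\<close> by (simp add: r_def)
  then have "1 * (\<bar>c\<bar> + real n) \<le> r * (a * r + b)" using ar \<open>a > 0\<close> by (intro mult_mono) auto
  then have "real n \<le> \<phi> (r *\<^sub>R u)" by (simp add: \<phi> power2_eq_square algebra_simps)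
  then show "\<exists>y\<in>UNIV. ereal (real n) \<le> ereal (\<phi> y)" by auto
qed

section \<open>Saddle points of the augmented Lagrangian solve problem (D)\<close>

context quadratic_dro
begin

abbreviation "C \<equiv> (UNIV :: (real^('n \<times> 'd)) set) \<times> {lam :: real^'n. 0 \<le> lam \<and> lambda_max Q *\<^sub>R 1 \<le> lam}"

abbreviation "saddle \<equiv> L_aug_saddle_point f \<epsilon> s v L C"

lemma in_C_iff: "(x, lam) \<in> C \<longleftrightarrow> 0 \<le> lam \<and> (\<forall>i. lambda_max Q \<le> lam $ i)"
  by (simp add: less_eq_vec_def)

lemma closed_C: "closed C"
proof -
  have "{lam :: real^'n. 0 \<le> lam \<and> lambda_max Q *\<^sub>R 1 \<le> lam} = {0..} \<inter> {lambda_max Q *\<^sub>R 1..}" by auto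
  then show ?thesis by (simp add: closed_Times closed_Int closed_eucl_atLeast)
qed

lemma convex_C: "convex C"
proof -
  have "convex {lam :: real^'n. a \<le> lam}" for a
    unfolding convex_alt
  proof clarify
    fix x y :: "real^'n" and t :: real assume *: "a \<le> x" "a \<le> y" "0 \<le> t" "t \<le> 1"
    have "a = (1 - t) *\<^sub>R a + t *\<^sub>R a" by (simp add: algebra_simps)
    also have "\<dots> \<le> (1 - t) *\<^sub>R x + t *\<^sub>R y" using * by (intro add_mono scaleR_left_mono) auto
    finally show "a \<le> (1 - t) *\<^sub>R x + t *\<^sub>R y" .
  qed
  then have "convex ({lam :: real^'n. 0 \<le> lam} \<inter> {lam. lambda_max Q *\<^sub>R 1 \<le> lam})" by (intro convex_Int)
  then show ?thesis by (intro convex_Times convex_UNIV) (simp add: Int_def)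
qed

lemma saddle_D:
  assumes "saddle x lam \<nu> \<eta> \<xi>"
  shows "(x, lam) \<in> C" "\<Phi> x lam \<nu>' \<eta>' \<xi>' \<le> \<Phi> x lam \<nu> \<eta> \<xi>"
    "(x', lam') \<in> C \<Longrightarrow> \<Phi> x lam \<nu> \<eta> \<xi> \<le> \<Phi> x' lam' \<nu> \<eta> \<xi>"
proof -
  note * = assms[unfolded L_aug_saddle_point_def saddle_point_def]
  show C: "(x, lam) \<in> C" using * by blast
  have "\<And>z w. z \<in> C \<Longrightarrow> (\<lambda>(x, lam) (\<nu>, \<eta>, \<xi>). \<Phi> x lam \<nu> \<eta> \<xi>) (x, lam) w \<le> (\<lambda>(x, lam) (\<nu>, \<eta>, \<xi>). \<Phi> x lam \<nu> \<eta> \<xi>) (x, lam) (\<nu>, \<eta>, \<xi>)"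
    "\<And>z w. z \<in> C \<Longrightarrow> (\<lambda>(x, lam) (\<nu>, \<eta>, \<xi>). \<Phi> x lam \<nu> \<eta> \<xi>) (x, lam) (\<nu>, \<eta>, \<xi>) \<le> (\<lambda>(x, lam) (\<nu>, \<eta>, \<xi>). \<Phi> x lam \<nu> \<eta> \<xi>) z (\<nu>, \<eta>, \<xi>)"
    using * by blast+
  from this(1)[OF C, of "(\<nu>', \<eta>', \<xi>')"] this(2)[of "(x', lam')"]
  show "\<Phi> x lam \<nu>' \<eta>' \<xi>' \<le> \<Phi> x lam \<nu> \<eta> \<xi>" "(x', lam') \<in> C \<Longrightarrow> \<Phi> x lam \<nu> \<eta> \<xi> \<le> \<Phi> x' lam' \<nu> \<eta> \<xi>"
    by (simp_all only: prod.case)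
qed

text \<open>The dual variables range over the whole space, so maximality in them forces a zero
  gradient. In particular every saddle point satisfies the consensus constraints.\<close>

lemma saddle_stationary:
  assumes "saddle x lam \<nu> \<eta> \<xi>"
  shows "L *v lam = 0" "M *v x = 0" "grad_xi x lam \<xi> = 0"
proof -
  define \<alpha> \<beta> \<zeta> where "\<alpha> = L *v lam" and "\<beta> = M *v x" and "\<zeta> = grad_xi x lam \<xi>"
  define c where "c = \<alpha> \<bullet> \<alpha> + \<beta> \<bullet> \<beta> + \<zeta> \<bullet> \<zeta>"
  define S where "S = slack lam \<zeta>"
  have "S \<ge> 0" unfolding S_def using saddle_D(1)[OF assms] in_C_iff by (intro slack_nonneg) blast
  have "c \<ge> 0" by (simp add: c_def)
  \<comment> \<open>A step \<open>t\<close> along the dual gradient gains \<open>t * c\<close> and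
    loses \<open>t\<^sup>2 * S\<close>. For this \<open>t\<close> with \<open>c > 0\<close> the gain
    wins, as \<open>t * S < t * (S + 1) = c\<close>.\<close>
  define t where "t = c / (S + 1)"
  have "slack lam (t *\<^sub>R \<zeta>) = t\<^sup>2 * S"
    unfolding S_def slack_def
    by (simp add: sum_distrib_left matrix_vector_mult_scaleR power2_eq_square algebra_simps)
  then have "t * c \<le> t\<^sup>2 * S"
    using saddle_D(2)[OF assms, of "\<nu> + t *\<^sub>R \<alpha>" "\<eta> + t *\<^sub>R \<beta>" "\<xi> + t *\<^sub>R \<zeta>"] dual_increment[of x lam \<nu> "t *\<^sub>R \<alpha>" \<eta> "t *\<^sub>R \<beta>" \<xi> "t *\<^sub>R \<zeta>"]
    by (simp add: c_def \<alpha>_def[symmetric] \<beta>_def[symmetric] \<zeta>_def[symmetric] algebra_simps)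
  have "c = 0"
  proof (rule ccontr)
    assume "c \<noteq> 0"
    then have "t > 0" using \<open>c \<ge> 0\<close> \<open>S \<ge> 0\<close> by (simp add: t_def)
    then have "c \<le> t * S" using \<open>t * c \<le> t\<^sup>2 * S\<close> by (simp add: power2_eq_square)
    moreover have "t * (S + 1) = c" using \<open>S \<ge> 0\<close> by (simp add: t_def)
    then have "c = t * S + t" by (simp add: distrib_left)
    ultimately show False using \<open>t > 0\<close> by linarith
  qed
  then have "\<alpha> \<bullet> \<alpha> = 0 \<and> \<beta> \<bullet> \<beta> = 0 \<and> \<zeta> \<bullet> \<zeta> = 0"
    using inner_ge_zero[of \<alpha>] inner_ge_zero[of \<beta>] inner_ge_zero[of \<zeta>] unfolding c_def by linarith
  then show "L *v lam = 0" "M *v x = 0" "grad_xi x lam \<xi> = 0"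
    by (simp_all add: \<alpha>_def \<beta>_def \<zeta>_def)
qed

lemma L_aug_feasible:
  assumes "L *v lam = 0" "M *v x = 0"
  shows "\<Phi> x lam \<nu> \<eta> \<xi> = h_reg \<epsilon> lam + 1 / real CARD('k) * (\<Sum>k\<in>UNIV. g_k f s k (block x (v k)) (lam $ v k) (\<xi> $ k))"
  using assms by (simp add: L_aug_def)

text \<open>Weak duality: on the consensus set the multiplier and augmentation terms vanish, and
  each supremum dominates the value at the chosen \<open>\<xi> $ k\<close>.\<close>

lemma F_obj_ge_L_aug:
  assumes "L *v lam = 0" "M *v x = 0"
  shows "ereal (\<Phi> x lam \<nu> \<eta> \<xi>) \<le> F_obj f \<epsilon> s v x lam"
proof -
  have "ereal (\<Phi> x lam \<nu> \<eta> \<xi>) = ereal (h_reg \<epsilon> lam) +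
      ereal (1 / real CARD('k)) * (\<Sum>k\<in>UNIV. ereal (g_k f s k (block x (v k)) (lam $ v k) (\<xi> $ k)))"
    by (simp add: L_aug_feasible[OF assms])
  also have "\<dots> \<le> F_obj f \<epsilon> s v x lam"
    unfolding F_obj_def by (intro add_left_mono ereal_mult_left_mono sum_mono SUP_upper) auto
  finally show ?thesis .
qed

lemma F_obj_saddle:
  assumes sp: "saddle x lam \<nu> \<eta> \<xi>"
  shows "F_obj f \<epsilon> s v x lam = ereal (\<Phi> x lam \<nu> \<eta> \<xi>)"
proof -
  note st = saddle_stationary[OF sp]
  have max: "g_k f s k (block x (v k)) (lam $ v k) y \<le> g_k f s k (block x (v k)) (lam $ v k) (\<xi> $ k)" for k y
  proof -
    \<comment> \<open>Maximality over all samples jointly separates: altering sample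
      \<open>k\<close> alone leaves the other summands unchanged, so \<open>\<xi> $ k\<close>
      maximizes its own term.\<close>
    define \<xi>' where "\<xi>' = (\<chi> j. if j = k then y else \<xi> $ j)"
    have "1 / real CARD('k) * (\<Sum>j\<in>UNIV. g_k f s j (block x (v j)) (lam $ v j) (\<xi>' $ j))
        \<le> 1 / real CARD('k) * (\<Sum>j\<in>UNIV. g_k f s j (block x (v j)) (lam $ v j) (\<xi> $ j))"
      using saddle_D(2)[OF sp, of \<nu> \<eta> \<xi>'] unfolding L_aug_feasible[OF st(1,2)] by linarith
    then have "(\<Sum>j\<in>UNIV. g_k f s j (block x (v j)) (lam $ v j) (\<xi>' $ j))
        \<le> (\<Sum>j\<in>UNIV. g_k f s j (block x (v j)) (lam $ v j) (\<xi> $ j))"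
      by (simp add: divide_le_cancel)
    moreover have "(\<Sum>j\<in>UNIV - {k}. g_k f s j (block x (v j)) (lam $ v j) (\<xi>' $ j))
        = (\<Sum>j\<in>UNIV - {k}. g_k f s j (block x (v j)) (lam $ v j) (\<xi> $ j))"
      by (intro sum.cong) (auto simp: \<xi>'_def)
    ultimately show ?thesis by (simp add: sum.remove[of UNIV k] \<xi>'_def)
  qed
  have "(SUP y. ereal (g_k f s k (block x (v k)) (lam $ v k) y)) = ereal (g_k f s k (block x (v k)) (lam $ v k) (\<xi> $ k))" for k
    by (intro antisym SUP_least SUP_upper) (auto simp: max)
  then show ?thesis by (simp add: F_obj_def L_aug_feasible[OF st(1,2)])
qed

text \<open>Surjectivity provides a sample held by agent \<open>i\<close>. Along an eigenvector of
  \<open>Q\<close> for \<open>lambda_max Q\<close>, its inner maximization has the positive leading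
  coefficient \<open>(lambda_max Q - lam $ i) * (u \<bullet> u)\<close>.\<close>

lemma F_obj_PInfty:
  assumes "surj v" "lam $ i < lambda_max Q"
  shows "F_obj f \<epsilon> s v x lam = \<infinity>"
proof -
  obtain k where k: "v k = i" using surjD[OF assms(1)] by metis
  obtain u where u: "u \<noteq> 0" "Q *v u = lambda_max Q *\<^sub>R u"
    using eigenvalue_lambda_max[OF Q_sym] by (auto simp: eigenvalue_def)
  define y c where "y = block x (v k)" and "c = lam $ v k"
  have "(SUP z. ereal (g_k f s k y c z)) = \<infinity>"
  proof (rule SUP_quadratic_PInfty)
    show "0 < (lambda_max Q - c) * (u \<bullet> u)" using assms(2) u(1) k by (simp add: c_def)
    show "g_k f s k y c (r *\<^sub>R u) = (lambda_max Q - c) * (u \<bullet> u) * r\<^sup>2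
        + (y \<bullet> (R *v u) + 2 * c * (u \<bullet> s k)) * r + (l y - c * (s k \<bullet> s k))" for r
    proof -
      have "(norm (r *\<^sub>R u - s k))\<^sup>2 = r\<^sup>2 * (u \<bullet> u) - 2 * r * (u \<bullet> s k) + s k \<bullet> s k"
        unfolding power2_norm_eq_inner
        by (simp add: inner_diff_left inner_diff_right inner_commute[of "s k" u] power2_eq_square algebra_simps)
      then show ?thesis
        unfolding g_k_def f_eq by (simp only:) (simp add: matrix_vector_mult_scaleR u(2) power2_eq_square algebra_simps)
    qed
  qed
  then have "(\<Sum>k\<in>UNIV. SUP z. ereal (g_k f s k (block x (v k)) (lam $ v k) z)) = \<infinity>"
    unfolding sum_Pinfty by (auto simp: y_def c_def)
  then show ?thesis by (simp add: F_obj_def)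
qed

text \<open>Feasible competitors inside \<open>C\<close> are handled by the saddle inequality
  followed by weak duality. Those outside have infinite objective, which reconciles the constraint
  of (D), \<open>0 \<le> lam\<close> only, with the smaller set \<open>C\<close>.\<close>

lemma saddle_imp_D_optimizer:
  assumes "surj v" and sp: "saddle x lam \<nu> \<eta> \<xi>"
  shows "D_optimizer f \<epsilon> s v L x lam"
  unfolding D_optimizer_def
proof (intro conjI, goal_cases)
  case 1
  then show ?case using saddle_stationary[OF sp] saddle_D(1)[OF sp] by (auto simp: D_feasible_def)
next
  case 2
  show ?case
  proof clarify
    fix x' :: "real^('n \<times> 'd)" and lam' assume "(x', lam') \<in> D_feasible L"
    then have feas: "0 \<le> lam'" "L *v lam' = 0" "M *v x' = 0" by (auto simp: D_feasible_def)
    show "F_obj f \<epsilon> s v x lam \<le> F_obj f \<epsilon> s v x' lam'"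
    proof (cases "\<forall>i. lambda_max Q \<le> lam' $ i")
      case True
      then have "(x', lam') \<in> C" using feas(1) in_C_iff by blast
      then have "ereal (\<Phi> x lam \<nu> \<eta> \<xi>) \<le> ereal (\<Phi> x' lam' \<nu> \<eta> \<xi>)" using saddle_D(3)[OF sp] by simp
      also have "\<dots> \<le> F_obj f \<epsilon> s v x' lam'" by (rule F_obj_ge_L_aug[OF feas(2,3)])
      finally show ?thesis by (simp add: F_obj_saddle[OF sp])
    next
      case False
      then show ?thesis using F_obj_PInfty[OF assms(1)] by (auto simp: not_le)
    qed
  qed
qed

end

section \<open>The dynamics (SP) as a convergent saddle-point flow\<close>

context quadratic_dro
begin

abbreviation "\<Psi> \<equiv> \<lambda>(x, lam) (\<nu>, \<eta>, \<xi>). \<Phi> x lam \<nu> \<eta> \<xi>"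
abbreviation "\<Psi>\<^sub>p \<equiv> \<lambda>(x, lam) (\<nu>, \<eta>, \<xi>). (grad_x x \<eta> \<xi>, grad_lam lam \<nu> \<xi>)"
abbreviation "\<Psi>\<^sub>q \<equiv> \<lambda>(x, lam) (\<nu>, \<eta>, \<xi>). (L *v lam, M *v x, grad_xi x lam \<xi>)"

lemma continuous_l: "continuous_on UNIV l"
proof (rule continuous_at_imp_continuous_on, rule ballI)
  fix x show "isCont l x" using g[of x] unfolding gderiv_def by (rule has_derivative_continuous)
qed

lemma trajectory_flow:
  assumes traj: "SP_trajectory f \<epsilon> s v L C x lam \<nu> \<eta> \<xi>" and start: "(x 0, lam 0) \<in> C"
  shows "saddle_flow \<Psi> \<Psi>\<^sub>p \<Psi>\<^sub>q C (\<lambda>t. (x t, lam t)) (\<lambda>t. (\<nu> t, \<eta> t, \<xi> t))"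
proof
  show "closed C" by (rule closed_C)
  show "convex C" by (rule convex_C)
  show "(x 0, lam 0) \<in> C" by (rule start)
  show "continuous_on UNIV (\<lambda>z. \<Psi> (fst z) (snd z))"
    unfolding case_prod_unfold L_aug_def h_reg_def g_k_def f_eq
    by (intro continuous_intros continuous_on_compose2[OF continuous_l]) auto
  show "continuous_on UNIV (\<lambda>z. \<Psi>\<^sub>p (fst z) (snd z))"
    unfolding case_prod_unfold grad_x_def grad_lam_def
    by (intro continuous_intros continuous_on_compose2[OF g_cont]) auto
  show "continuous_on UNIV (\<lambda>z. \<Psi>\<^sub>q (fst z) (snd z))"
    unfolding case_prod_unfold grad_xi_def by (intro continuous_intros)
  show "\<Psi> z w + \<Psi>\<^sub>p z w \<bullet> (z' - z) \<le> \<Psi> z' w" for z z' w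
  proof -
    obtain x lam x' lam' \<nu> \<eta> \<xi> where eq: "z = (x, lam)" "z' = (x', lam')" "w = (\<nu>, \<eta>, \<xi>)" by (metis prod.exhaust)
    have "0 \<le> (1 / real CARD('k)) * rem_l x (x' - x) + 1/2 * ((x' - x) \<bullet> (M *v (x' - x))) + 1/2 * ((lam' - lam) \<bullet> (L *v (lam' - lam)))"
      using rem_l_nonneg[of x "x' - x"] M_psd[of "x' - x"] L_psd[of "lam' - lam"] by simp
    then show ?thesis using primal_increment[of x "x' - x" lam "lam' - lam" \<nu> \<eta> \<xi>]
      by (simp add: eq inner_commute[of "grad_x _ _ _"] inner_commute[of "grad_lam _ _ _"])
  qed
  show "\<Psi> z w' \<le> \<Psi> z w + \<Psi>\<^sub>q z w \<bullet> (w' - w)" if z: "z \<in> C" for z w w'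
  proof -
    obtain x lam \<nu> \<eta> \<xi> \<nu>' \<eta>' \<xi>' where eq: "z = (x, lam)" "w = (\<nu>, \<eta>, \<xi>)" "w' = (\<nu>', \<eta>', \<xi>')" by (metis prod.exhaust)
    have "0 \<le> slack lam (\<xi>' - \<xi>)" using z in_C_iff unfolding eq by (intro slack_nonneg) blast
    then show ?thesis using dual_increment[of x lam \<nu> "\<nu>' - \<nu>" \<eta> "\<eta>' - \<eta>" \<xi> "\<xi>' - \<xi>"]
      by (simp add: eq inner_commute[of "L *v lam"] inner_commute[of "M *v x"] inner_commute[of "grad_xi _ _ _"])
  qed
  show "abs_continuous_on {0..T} (\<lambda>t. ((x t, lam t), (\<nu> t, \<eta> t, \<xi> t)))" if "T \<ge> 0" for T
  \<comment> \<open>Regrouping the nested tuple into a primal and a dual pair is an isometry, hence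
    the constant 1 below.\<close>
  proof (rule abs_continuous_on_lipschitz[OF _ order_refl])
    show "abs_continuous_on {0..T} (\<lambda>t. (x t, lam t, \<nu> t, \<eta> t, \<xi> t))"
      using traj that unfolding SP_trajectory_def by blast
    fix t r
    show "norm (((x r, lam r), (\<nu> r, \<eta> r, \<xi> r)) - ((x t, lam t), (\<nu> t, \<eta> t, \<xi> t)))
        \<le> 1 * norm ((x r, lam r, \<nu> r, \<eta> r, \<xi> r) - (x t, lam t, \<nu> t, \<eta> t, \<xi> t))"
      by (simp add: norm_Pair)
  qed
  have "AE t in lebesgue. t > 0 \<longrightarrow>
        (\<exists>p. ((\<lambda>r. (x r, lam r)) has_vector_derivative p) (at t) \<and>
             proj_direction C (x t, lam t) (- grad_x (x t) (\<eta> t) (\<xi> t), - grad_lam (lam t) (\<nu> t) (\<xi> t)) p) \<and>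
        (\<nu> has_vector_derivative L *v lam t) (at t) \<and> (\<eta> has_vector_derivative M *v x t) (at t) \<and>
        (\<forall>k. ((\<lambda>r. \<xi> r $ k) has_vector_derivative grad_xi (x t) (lam t) (\<xi> t) $ k) (at t))"
    using traj unfolding SP_trajectory_def grad_L_aug_x grad_L_aug_lam grad_L_aug_nu grad_L_aug_eta grad_L_aug_xi
    by blast
  then show "AE t in lebesgue. t > 0 \<longrightarrow>
        (\<exists>p'. ((\<lambda>t. (x t, lam t)) has_vector_derivative p') (at t) \<and>
          proj_direction C (x t, lam t) (- \<Psi>\<^sub>p (x t, lam t) (\<nu> t, \<eta> t, \<xi> t)) p') \<and>
        ((\<lambda>t. (\<nu> t, \<eta> t, \<xi> t)) has_vector_derivative \<Psi>\<^sub>q (x t, lam t) (\<nu> t, \<eta> t, \<xi> t)) (at t)"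
  proof eventually_elim
    case (elim t)
    show ?case
    proof
      assume "t > 0"
      note e = elim[THEN mp, OF this]
      have "(\<xi> has_vector_derivative grad_xi (x t) (lam t) (\<xi> t)) (at t)"
        by (rule has_vector_derivative_vec) (use e in blast)
      then have "((\<lambda>t. (\<nu> t, \<eta> t, \<xi> t)) has_vector_derivative (L *v lam t, M *v x t, grad_xi (x t) (lam t) (\<xi> t))) (at t)"
        using e by (intro has_vector_derivative_Pair) auto
      then show "(\<exists>p'. ((\<lambda>t. (x t, lam t)) has_vector_derivative p') (at t) \<and>
          proj_direction C (x t, lam t) (- \<Psi>\<^sub>p (x t, lam t) (\<nu> t, \<eta> t, \<xi> t)) p') \<and>
        ((\<lambda>t. (\<nu> t, \<eta> t, \<xi> t)) has_vector_derivative \<Psi>\<^sub>q (x t, lam t) (\<nu> t, \<eta> t, \<xi> t)) (at t)"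
        using e by simp
    qed
  qed
qed

lemma trajectory_converges:
  assumes traj: "SP_trajectory f \<epsilon> s v L C x lam \<nu> \<eta> \<xi>" and start: "(x 0, lam 0) \<in> C"
    and sp: "saddle xs lams \<nu>s \<eta>s \<xi>s" and strict: "\<And>i. lambda_max Q < lams $ i"
  shows "convergent_saddle_flow \<Psi> \<Psi>\<^sub>p \<Psi>\<^sub>q C (\<lambda>t. (x t, lam t)) (\<lambda>t. (\<nu> t, \<eta> t, \<xi> t)) (xs, lams) (\<nu>s, \<eta>s, \<xi>s)"
proof -
  interpret saddle_flow \<Psi> \<Psi>\<^sub>p \<Psi>\<^sub>q C "\<lambda>t. (x t, lam t)" "\<lambda>t. (\<nu> t, \<eta> t, \<xi> t)"
    by (rule trajectory_flow[OF traj start])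
  note st = saddle_stationary[OF sp]
  \<comment> \<open>By the exact increments the dissipation is a sum of nonnegative terms: the gap
    \<open>\<Phi> x' lam' \<nu>s \<eta>s \<xi>s - \<Phi> xs lams \<nu>s \<eta>s \<xi>s\<close>, the
    remainder of \<open>l\<close>, the two halved Laplacian forms at \<delta> and \<mu>, and a slack
    at each of \<open>lam'\<close> and \<open>lams\<close>. If it vanishes, so does each of
    them.\<close>
  have zero: "L *v lam' = 0 \<and> M *v x' = 0 \<and> \<xi>' = \<xi>s"
    if xC: "(x', lam') \<in> C" and D: "dissipation (xs, lams) (\<nu>s, \<eta>s, \<xi>s) (x', lam') (\<nu>', \<eta>', \<xi>') = 0"
    for x' lam' \<nu>' \<eta>' \<xi>'
  proof -
    define \<delta> \<mu> \<zeta> where "\<delta> = xs - x'" and "\<mu> = lams - lam'" and "\<zeta> = \<xi>' - \<xi>s"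
    have sl': "0 \<le> slack lam' (\<xi>s - \<xi>')" using xC in_C_iff by (intro slack_nonneg) blast
    have sl: "0 \<le> slack lams \<zeta>" using strict by (intro slack_nonneg) (simp add: less_imp_le)
    have P: "\<Phi> xs lams \<nu>' \<eta>' \<xi>' = \<Phi> x' lam' \<nu>' \<eta>' \<xi>' + \<delta> \<bullet> grad_x x' \<eta>' \<xi>' + \<mu> \<bullet> grad_lam lam' \<nu>' \<xi>'
     + (1 / real CARD('k)) * rem_l x' \<delta> + 1/2 * (\<delta> \<bullet> (M *v \<delta>)) + 1/2 * (\<mu> \<bullet> (L *v \<mu>))"
      using primal_increment[of x' \<delta> lam' \<mu>] by (simp add: \<delta>_def \<mu>_def)
    have "\<Phi> x' lam' \<nu>s \<eta>s \<xi>s = \<Phi> x' lam' \<nu>' \<eta>' \<xi>' + (\<nu>s - \<nu>') \<bullet> (L *v lam') + (\<eta>s - \<eta>') \<bullet> (M *v x')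
     + (\<xi>s - \<xi>') \<bullet> grad_xi x' lam' \<xi>' - slack lam' (\<xi>s - \<xi>')"
      using dual_increment[of x' lam' \<nu>' "\<nu>s - \<nu>'" \<eta>' "\<eta>s - \<eta>'" \<xi>' "\<xi>s - \<xi>'"] by simp
    moreover have "\<Phi> xs lams \<nu>s \<eta>s \<xi>s \<le> \<Phi> x' lam' \<nu>s \<eta>s \<xi>s" by (rule saddle_D(3)[OF sp xC])
    \<comment> \<open>Stationarity removes the linear terms, leaving the slack at the reference
      multipliers \<open>lams\<close>. It is definite even when \<open>lam'\<close> touches the
      bound, which is what identifies \<open>\<xi>'\<close>.\<close>
    moreover have "\<Phi> xs lams \<nu>' \<eta>' \<xi>' = \<Phi> xs lams \<nu>s \<eta>s \<xi>s - slack lams \<zeta>"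
      using dual_increment[of xs lams \<nu>s "\<nu>' - \<nu>s" \<eta>s "\<eta>' - \<eta>s" \<xi>s "\<zeta>"] st by (simp add: \<zeta>_def)
    moreover have "- (\<delta> \<bullet> grad_x x' \<eta>' \<xi>' + \<mu> \<bullet> grad_lam lam' \<nu>' \<xi>') + ((\<nu>s - \<nu>') \<bullet> (L *v lam') + (\<eta>s - \<eta>') \<bullet> (M *v x')
     + (\<xi>s - \<xi>') \<bullet> grad_xi x' lam' \<xi>') = 0"
      using D unfolding dissipation_def \<delta>_def \<mu>_def
      by (simp add: inner_diff_left inner_diff_right inner_commute)
    moreover have "0 \<le> (1 / real CARD('k)) * rem_l x' \<delta>" using rem_l_nonneg by simp
    ultimately have "slack lams \<zeta> = 0 \<and> \<delta> \<bullet> (M *v \<delta>) = 0 \<and> \<mu> \<bullet> (L *v \<mu>) = 0"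
      using sl sl' P M_psd[of \<delta>] L_psd[of \<mu>] by linarith
    then have "\<zeta> = 0" "M *v \<delta> = 0" "L *v \<mu> = 0"
      using slack_eq_0[OF strict] psd_quadratic_zero[OF M_sym M_psd] psd_quadratic_zero[OF L_sym L_psd] by blast+
    then show ?thesis using st by (simp add: \<zeta>_def \<delta>_def \<mu>_def matrix_vector_mult_diff_distrib)
  qed
  show ?thesis
  proof
    show "saddle_point \<Psi> C UNIV (xs, lams) (\<nu>s, \<eta>s, \<xi>s)" using sp unfolding L_aug_saddle_point_def .
    fix e :: "(real^'n) \<times> (real^('n \<times> 'd)) \<times> (real^'m^'k)" assume "e \<in> Basis"
    \<comment> \<open>In the \<nu> and \<eta> directions the velocities \<open>L *v lam'\<close> and
      \<open>M *v x'\<close> vanish with the dissipation; in the \<xi> directions the coordinate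
      itself is determined.\<close>
    then consider u w where "e = (u, w, 0)" | u where "e = (0, 0, u)" by (auto simp: Basis_prod_def zero_prod_def)
    then show "(\<forall>z\<in>C. \<forall>y. dissipation (xs, lams) (\<nu>s, \<eta>s, \<xi>s) z y = 0 \<longrightarrow> y \<bullet> e = (\<nu>s, \<eta>s, \<xi>s) \<bullet> e) \<or>
      (\<forall>z\<in>C. \<forall>y. dissipation (xs, lams) (\<nu>s, \<eta>s, \<xi>s) z y = 0 \<longrightarrow> \<Psi>\<^sub>q z y \<bullet> e = 0)"
    proof cases
      case 1
      have "\<Psi>\<^sub>q z y \<bullet> e = 0" if "z \<in> C" "dissipation (xs, lams) (\<nu>s, \<eta>s, \<xi>s) z y = 0" for z y
      proof -
        obtain x' lam' \<nu>' \<eta>' \<xi>' where eq: "z = (x', lam')" "y = (\<nu>', \<eta>', \<xi>')" by (metis prod.exhaust)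
        show ?thesis using zero[OF that[unfolded eq]] by (simp add: eq 1)
      qed
      then show ?thesis by blast
    next
      case 2
      have "y \<bullet> e = (\<nu>s, \<eta>s, \<xi>s) \<bullet> e" if "z \<in> C" "dissipation (xs, lams) (\<nu>s, \<eta>s, \<xi>s) z y = 0" for z y
      proof -
        obtain x' lam' \<nu>' \<eta>' \<xi>' where eq: "z = (x', lam')" "y = (\<nu>', \<eta>', \<xi>')" by (metis prod.exhaust)
        show ?thesis using zero[OF that[unfolded eq]] by (simp add: eq 2)
      qed
      then show ?thesis by blast
    qed
  qed
qed

end

theorem mainTheorem9:
  fixes \<epsilon> :: real
    and E :: "('n::finite \<times> 'n) set"
    and A :: "real^'n^'n"
    and s :: "'k::finite \<Rightarrow> real^'m::finite"
    and v :: "'k \<Rightarrow> 'n"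
    and f :: "real^'d::finite \<Rightarrow> real^'m \<Rightarrow> real"
    and Q :: "real^'m^'m"
    and R :: "real^'m^'d"
    and l :: "real^'d \<Rightarrow> real"
    and L :: "real^'n^'n"
    and C :: "((real^('n \<times> 'd)) \<times> (real^'n)) set"
    and xs :: "real^('n \<times> 'd)" and lams \<nu>s :: "real^'n"
    and \<eta>s :: "real^('n \<times> 'd)" and \<xi>s :: "real^'m^'k"
  assumes "\<epsilon> \<ge> 0"
    and "connected_weighted_graph E A"
    and "L = laplacian A"
    and "surj v"
    and "closure {\<xi>. \<not> recession_direction (\<lambda>x. f x \<xi>) 1 \<and>
                     \<not> recession_direction (\<lambda>x. f x \<xi>) (- 1)} = UNIV"
    and "interior {(lam, x). 0 \<le> lam \<and> \<bar>P_objective f \<epsilon> s lam x\<bar> \<noteq> \<infinity>} \<noteq> {}"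
    and "\<exists>lam x. 0 \<le> lam \<and> \<bar>P_objective f \<epsilon> s lam x\<bar> \<noteq> \<infinity> \<and>
           (\<forall>lam' x'. 0 \<le> lam' \<longrightarrow> P_objective f \<epsilon> s lam x \<le> P_objective f \<epsilon> s lam' x')"
    and "\<And>x \<xi>. f x \<xi> = \<xi> \<bullet> (Q *v \<xi>) + x \<bullet> (R *v \<xi>) + l x"
    and "positive_definite Q"
    and "cont_diff l"
    and "convex_on UNIV l"
    and "C = UNIV \<times> {lam. 0 \<le> lam \<and> lambda_max Q *\<^sub>R 1 \<le> lam}"
    and "L_aug_saddle_point f \<epsilon> s v L C xs lams \<nu>s \<eta>s \<xi>s"
    and "\<forall>i. lambda_max Q < lams $ i"
  shows "\<forall>x lam \<nu> \<eta> \<xi>. SP_trajectory f \<epsilon> s v L C x lam \<nu> \<eta> \<xi> \<and> (x 0, lam 0) \<in> C \<longrightarrow>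
           (\<forall>t\<ge>0. (x t, lam t) \<in> C) \<and>
           (\<exists>x\<^sub>0 lam\<^sub>0 \<nu>\<^sub>0 \<eta>\<^sub>0 \<xi>\<^sub>0. L_aug_saddle_point f \<epsilon> s v L C x\<^sub>0 lam\<^sub>0 \<nu>\<^sub>0 \<eta>\<^sub>0 \<xi>\<^sub>0 \<and>
              ((\<lambda>t. (x t, lam t, \<nu> t, \<eta> t, \<xi> t)) \<longlongrightarrow> (x\<^sub>0, lam\<^sub>0, \<nu>\<^sub>0, \<eta>\<^sub>0, \<xi>\<^sub>0)) at_top) \<and>
           (\<exists>x\<^sub>0 lam\<^sub>0. D_optimizer f \<epsilon> s v L x\<^sub>0 lam\<^sub>0 \<and>
              ((\<lambda>t. (x t, lam t)) \<longlongrightarrow> (x\<^sub>0, lam\<^sub>0)) at_top)"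
proof -
  obtain g where g: "\<And>x. GDERIV l x :> g x" "continuous_on UNIV g"
    using \<open>cont_diff l\<close> by (auto simp: cont_diff_def)
  have Q_sym: "transpose Q = Q" using \<open>positive_definite Q\<close> by (simp add: positive_definite_def)
  have A: "transpose A = A" using \<open>connected_weighted_graph E A\<close> by (simp add: connected_weighted_graph_def)
  have A_nonneg: "0 \<le> A $ i $ j" for i j
    using \<open>connected_weighted_graph E A\<close> unfolding connected_weighted_graph_def
    by (cases "(i, j) \<in> E") (auto simp: less_imp_le)
  interpret quadratic_dro \<epsilon> s v f Q R l g L
    using assms(8) Q_sym laplacian_symmetric[OF A] laplacian_psd[OF A A_nonneg] g \<open>convex_on UNIV l\<close>
    unfolding \<open>L = laplacian A\<close> by unfold_locales
  note C_eq = assms(12)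
  show ?thesis
  proof (intro allI impI, elim conjE)
    fix x :: "real \<Rightarrow> real^('n \<times> 'd)" and lam \<nu> :: "real \<Rightarrow> real^'n" and \<eta> :: "real \<Rightarrow> real^('n \<times> 'd)"
      and \<xi> :: "real \<Rightarrow> real^'m^'k"
    assume traj: "SP_trajectory f \<epsilon> s v L C x lam \<nu> \<eta> \<xi>" and start: "(x 0, lam 0) \<in> C"
    interpret convergent_saddle_flow \<Psi> \<Psi>\<^sub>p \<Psi>\<^sub>q C "\<lambda>t. (x t, lam t)" "\<lambda>t. (\<nu> t, \<eta> t, \<xi> t)" "(xs, lams)" "(\<nu>s, \<eta>s, \<xi>s)"
      unfolding C_eq by (rule trajectory_converges) (use traj start assms(13,14) C_eq in simp_all)
    obtain z w where zw: "saddle_point \<Psi> C UNIV z w" "((\<lambda>t. ((x t, lam t), (\<nu> t, \<eta> t, \<xi> t))) \<longlongrightarrow> (z, w)) at_top"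
      using converges_to_saddle_point by blast
    obtain x\<^sub>0 lam\<^sub>0 \<nu>\<^sub>0 \<eta>\<^sub>0 \<xi>\<^sub>0 where eq: "z = (x\<^sub>0, lam\<^sub>0)" "w = (\<nu>\<^sub>0, \<eta>\<^sub>0, \<xi>\<^sub>0)" by (metis prod.exhaust)
    have sp: "L_aug_saddle_point f \<epsilon> s v L C x\<^sub>0 lam\<^sub>0 \<nu>\<^sub>0 \<eta>\<^sub>0 \<xi>\<^sub>0"
      using zw(1) unfolding eq L_aug_saddle_point_def .
    have lim_p: "((\<lambda>t. (x t, lam t)) \<longlongrightarrow> (x\<^sub>0, lam\<^sub>0)) at_top" using tendsto_fst[OF zw(2)] by (simp add: eq)
    have lim_q: "((\<lambda>t. (\<nu> t, \<eta> t, \<xi> t)) \<longlongrightarrow> (\<nu>\<^sub>0, \<eta>\<^sub>0, \<xi>\<^sub>0)) at_top" using tendsto_snd[OF zw(2)] by (simp add: eq)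
    have "((\<lambda>t. (x t, lam t, \<nu> t, \<eta> t, \<xi> t)) \<longlongrightarrow> (x\<^sub>0, lam\<^sub>0, \<nu>\<^sub>0, \<eta>\<^sub>0, \<xi>\<^sub>0)) at_top"
      using tendsto_Pair[OF tendsto_fst[OF lim_p] tendsto_Pair[OF tendsto_snd[OF lim_p] lim_q]] by simp
    moreover have "D_optimizer f \<epsilon> s v L x\<^sub>0 lam\<^sub>0"
      by (rule saddle_imp_D_optimizer[OF \<open>surj v\<close> sp[unfolded C_eq]])
    ultimately show "(\<forall>t\<ge>0. (x t, lam t) \<in> C) \<and>
           (\<exists>x\<^sub>0 lam\<^sub>0 \<nu>\<^sub>0 \<eta>\<^sub>0 \<xi>\<^sub>0. L_aug_saddle_point f \<epsilon> s v L C x\<^sub>0 lam\<^sub>0 \<nu>\<^sub>0 \<eta>\<^sub>0 \<xi>\<^sub>0 \<and>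
              ((\<lambda>t. (x t, lam t, \<nu> t, \<eta> t, \<xi> t)) \<longlongrightarrow> (x\<^sub>0, lam\<^sub>0, \<nu>\<^sub>0, \<eta>\<^sub>0, \<xi>\<^sub>0)) at_top) \<and>
           (\<exists>x\<^sub>0 lam\<^sub>0. D_optimizer f \<epsilon> s v L x\<^sub>0 lam\<^sub>0 \<and>
              ((\<lambda>t. (x t, lam t)) \<longlongrightarrow> (x\<^sub>0, lam\<^sub>0)) at_top)"
      using p_in_C sp lim_p by blast
  qed
qed

end
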